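(* Let $X$ be a real convex-transitive Banach space, $u\in S_X$, and suppose there is a bicontractive linear projection $P:X\to[u]$. Assume that (i) the set $\omega\text{-}\exp(B_X)$ of weakly exposed points of $B_X$ is norm-dense in $S_X$; and (ii) the set-valued map $u\circ J:(S_X,\omega)\to\mathcal{P}([-1,1])$, $x\mapsto\{g(u): g\in J(x)\}$, is upper semi-continuous at $u$, where $S_X$ carries the relative weak topology. Then $X$ is isometrically a Hilbert space.
   Context: $X$ is convex-transitive if $\overline{\mathrm{conv}}(\{T(y):T\in\mathcal{G}_X\})=B_X$ for every $y\in S_X$, where $\mathcal{G}_X$ is the group of surjective linear isometries. $P$ is bicontractive if $\|P\|\le1$ and $\|I-P\|\le1$. A point $x\in S_X$ is weakly exposed by $f\in S_{X^*}$ if every $(x_n)\subset B_X$ with $f(x_n)\to1$ converges weakly to $x$. The duality map is $J(x)=\{f\in S_{X^*}: f(x)=1\}$. A set-valued map $F$ from a topological space $T$ to subsets of $Y$ is upper semi-continuous at $t$ if for every open $V\supset F(t)$ there is an open neighbourhood $U$ of $t$ with $F(s)\subset V$ for all $s\in U$. *)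

theory Defs
  imports "HOL-Analysis.Analysis"
begin

text \<open>Real Banach spaces are types of class banach (scalars are real).
  The dual space is represented by bounded linear functionals, with the operator norm onorm.\<close>

definition dual_sphere :: "('a::real_normed_vector \<Rightarrow> real) set" where
  "dual_sphere = {f. bounded_linear f \<and> onorm f = 1}"

definition isometry_group :: "('a::real_normed_vector \<Rightarrow> 'a) set" where
  "isometry_group = {T. linear T \<and> surj T \<and> (\<forall>x. norm (T x) = norm x)}"

definition convex_transitive :: "'a::real_normed_vector itself \<Rightarrow> bool" where
  "convex_transitive _ \<longleftrightarrow>
     (\<forall>y::'a. norm y = 1 \<longrightarrow>
        closure (convex hull {T y | T. T \<in> isometry_group}) = cball 0 1)"

definition bicontractive :: "('a::real_normed_vector \<Rightarrow> 'a) \<Rightarrow> bool" where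
  "bicontractive P \<longleftrightarrow> bounded_linear P \<and> onorm P \<le> 1 \<and> onorm (\<lambda>x. x - P x) \<le> 1"

definition projection_onto :: "('a::real_normed_vector \<Rightarrow> 'a) \<Rightarrow> 'a set \<Rightarrow> bool" where
  "projection_onto P S \<longleftrightarrow> linear P \<and> (\<forall>x. P (P x) = P x) \<and> range P = S"

definition weak_converges :: "(nat \<Rightarrow> 'a::real_normed_vector) \<Rightarrow> 'a \<Rightarrow> bool" where
  "weak_converges xs x \<longleftrightarrow> (\<forall>f. bounded_linear f \<longrightarrow> (\<lambda>n. f (xs n) :: real) \<longlonglongrightarrow> f x)"

definition weakly_exposed_by :: "'a::real_normed_vector \<Rightarrow> ('a \<Rightarrow> real) \<Rightarrow> bool" where
  "weakly_exposed_by x f \<longleftrightarrow> norm x = 1 \<and> f \<in> dual_sphere \<and>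
     (\<forall>xs. (\<forall>n. norm (xs n) \<le> 1) \<longrightarrow> (\<lambda>n. f (xs n)) \<longlonglongrightarrow> 1 \<longrightarrow> weak_converges xs x)"

definition weakly_exposed_points :: "'a::real_normed_vector set" where
  "weakly_exposed_points = {x. \<exists>f. weakly_exposed_by x f}"

definition duality_map :: "'a::real_normed_vector \<Rightarrow> ('a \<Rightarrow> real) set" where
  "duality_map x = {f \<in> dual_sphere. f x = 1}"

definition weak_topology :: "'a::real_normed_vector topology" where
  "weak_topology = topology_generated_by {f -` U | f U. bounded_linear f \<and> open (U::real set)}"

definition usc_at :: "'b topology \<Rightarrow> ('b \<Rightarrow> real set) \<Rightarrow> 'b \<Rightarrow> bool" where
  "usc_at T F t \<longleftrightarrow> (\<forall>V. open V \<and> F t \<subseteq> V \<longrightarrow>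
      (\<exists>U. openin T U \<and> t \<in> U \<and> (\<forall>s\<in>U. F s \<subseteq> V)))"

text \<open>X is isometrically a Hilbert space: its norm comes from an inner product
  (completeness is given by the class banach).\<close>
definition norm_from_inner_product :: "'a::real_normed_vector itself \<Rightarrow> bool" where
  "norm_from_inner_product _ \<longleftrightarrow>
     (\<exists>ip :: 'a \<Rightarrow> 'a \<Rightarrow> real.
        (\<forall>x y. ip x y = ip y x) \<and>
        (\<forall>y. linear (\<lambda>x. ip x y)) \<and>
        (\<forall>x. 0 \<le> ip x x) \<and> (\<forall>x. ip x x = 0 \<longrightarrow> x = 0) \<and>
        (\<forall>x. norm x = sqrt (ip x x)))"

end

theory Submission
  imports Defs
begin

text \<open>
  Write \<open>P x = f x *\<^sub>R u\<close>. Transporting \<open>(u, f)\<close> by isometries and passing to weak limits, every unit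
  vector \<open>x\<close> acquires a support functional \<open>\<phi>\<close> for which \<open>I - \<phi> \<otimes> x\<close> is a contraction. Density of the exposed
  points then forces the norm to be smooth, so that Birkhoff orthogonality (\<open>D x y = 0\<close>, where \<open>D x\<close> is the derivative
  of the norm at \<open>x\<close>) is symmetric and additive.

  In dimension at least three, move \<open>l\<close> along a sphere inside the kernel of \<open>D k\<close>: its velocity is orthogonal to
  \<open>l\<close> and to \<open>k\<close>, hence to \<open>l + k\<close>, so \<open>norm (l + k)\<close> depends only on \<open>norm l\<close> and \<open>k\<close>. It follows that
  every orthonormal pair spans a Euclidean plane. In dimension two, orthogonality alone does not suffice (Radon curves);
  there an extremal ellipse is invariant under all isometries, and convex-transitivity makes it the unit circle.
\<close>

section \<open>Norm-one functionals and isometries\<close>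

lemma dual_sphere_le_norm:
  assumes "h \<in> dual_sphere"
  shows "\<bar>h v\<bar> \<le> norm v"
  using assms onorm[of h v] by (auto simp: dual_sphere_def)

lemma bounded_linear_of_le_norm:
  fixes g :: "'a::real_normed_vector \<Rightarrow> real"
  assumes "linear g" "\<And>v. \<bar>g v\<bar> \<le> norm v"
  shows "bounded_linear g"
  using assms by (intro bounded_linear_intro[of g 1]) (auto simp: linear_add linear_scale)

lemma dual_sphereI:
  fixes g :: "'a::real_normed_vector \<Rightarrow> real"
  assumes "linear g" "\<And>v. \<bar>g v\<bar> \<le> norm v" "norm x = 1" "g x = 1"
  shows "g \<in> dual_sphere"
proof -
  have bl: "bounded_linear g" using assms(1,2) by (rule bounded_linear_of_le_norm)
  have "onorm g \<le> 1" using assms(2) by (intro onorm_bound) auto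
  moreover have "1 \<le> onorm g" using onorm[OF bl, of x] assms by simp
  ultimately show ?thesis using bl by (simp add: dual_sphere_def)
qed

lemma isometry_group_inv:
  assumes "T \<in> isometry_group"
  shows "inv T \<in> isometry_group" "\<And>x. T (inv T x) = x" "\<And>x. inv T (T x) = x"
proof -
  have T: "linear T" "surj T" "\<And>x. norm (T x) = norm x"
    using assms by (auto simp: isometry_group_def)
  have inj: "inj T"
    using T(1,3) by (metis linear_injective_0 norm_eq_zero)
  show a: "T (inv T x) = x" for x using T(2) by (simp add: surj_f_inv_f)
  show b: "inv T (T x) = x" for x using inj by simp
  have "linear (inv T)"
  proof (rule linearI)
    fix x y c
    have "inv T (x + y) = inv T (T (inv T x + inv T y))" by (simp only: linear_add[OF T(1)] a)
    then show "inv T (x + y) = inv T x + inv T y" by (simp only: b)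
    have "inv T (c *\<^sub>R x) = inv T (T (c *\<^sub>R inv T x))" by (simp only: linear_scale[OF T(1)] a)
    then show "inv T (c *\<^sub>R x) = c *\<^sub>R inv T x" by (simp only: b)
  qed
  moreover have "surj (inv T)" using b by (rule surjI)
  moreover have "norm (inv T x) = norm x" for x using T(3)[of "inv T x"] by (simp add: a)
  ultimately show "inv T \<in> isometry_group" by (simp add: isometry_group_def)
qed

lemma le_norm_comp_isometry:
  fixes g :: "'a::real_normed_vector \<Rightarrow> real"
  assumes "T \<in> isometry_group" "linear g" "\<And>v. \<bar>g v\<bar> \<le> norm v"
  shows "linear (g \<circ> T)" "\<And>v. \<bar>(g \<circ> T) v\<bar> \<le> norm v"
proof -
  have T: "linear T" "\<And>x. norm (T x) = norm x"
    using assms(1) by (auto simp: isometry_group_def)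
  show "linear (g \<circ> T)" using T(1) assms(2) by (rule linear_compose)
  show "\<bar>(g \<circ> T) v\<bar> \<le> norm v" for v using assms(3)[of "T v"] T(2) by simp
qed

text \<open>If every \<open>h (T y)\<close> were at most \<open>1 - e\<close>, the closed half-space
  \<open>{x. h x \<le> 1 - e}\<close> would contain the orbit of \<open>y\<close>, hence the unit
  ball by convex-transitivity, against \<open>onorm h = 1\<close>.\<close>

lemma convex_transitive_functional:
  fixes y :: "'a::real_normed_vector"
  assumes ct: "convex_transitive TYPE('a)" and "h \<in> dual_sphere" "norm y = 1" "0 < e"
  shows "\<exists>T\<in>isometry_group. 1 - e < h (T y)"
proof (rule ccontr)
  assume "\<not> ?thesis"
  then have le: "\<And>T. T \<in> isometry_group \<Longrightarrow> h (T y) \<le> 1 - e" by force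
  have bl: "bounded_linear h" and on: "onorm h = 1" using assms(2) by (auto simp: dual_sphere_def)
  then have lin: "linear h" by (simp add: bounded_linear.linear)
  let ?H = "{x. h x \<le> 1 - e}"
  have "convex ?H"
    using convex_linear_vimage[OF lin, of "{..1 - e}"] by (simp add: vimage_def)
  moreover have "closed ?H"
    using bl by (intro closed_Collect_le linear_continuous_on continuous_on_const)
  ultimately have "closure (convex hull {T y | T. T \<in> isometry_group}) \<subseteq> ?H"
    using le by (intro closure_minimal hull_minimal) auto
  then have ball: "h x \<le> 1 - e" if "norm x \<le> 1" for x
    using ct assms(3) that unfolding convex_transitive_def by (metis (lifting) mem_Collect_eq mem_cball_0 subsetD)
  have "0 \<le> 1 - e" using ball[of 0] linear_0[OF lin] by simp
  have "onorm h \<le> 1 - e"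
  proof (rule onorm_bound)
    fix x show "norm (h x) \<le> (1 - e) * norm x"
    proof (cases "x = 0")
      case False
      have "h (x /\<^sub>R norm x) \<le> 1 - e" "h ((- x) /\<^sub>R norm x) \<le> 1 - e"
        using False by (auto intro!: ball)
      then have "\<bar>h x\<bar> / norm x \<le> 1 - e" using False
        by (auto simp: linear_scale[OF lin] linear_neg[OF lin] abs_if divide_inverse_commute simp del: scaleR_minus_right)
      then show ?thesis using False by (simp add: divide_simps)
    qed (simp add: linear_0[OF lin])
  qed fact
  with on \<open>0 < e\<close> show False by simp
qed

section \<open>The weak topology\<close>

text \<open>Ties the sequential \<open>weak_converges\<close> to \<open>weak_topology\<close>: on a
  subbasic set this is convergence of a single functional, and eventual membership passes to finite
  intersections and to unions.\<close>

lemma weak_converges_eventually: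
  assumes "weak_converges xs x" "openin weak_topology W" "x \<in> W"
  shows "\<forall>\<^sub>F n in sequentially. xs n \<in> W"
proof -
  have "generate_topology_on {f -` U | f U. bounded_linear f \<and> open (U::real set)} W"
    using assms(2) by (simp add: weak_topology_def openin_topology_generated_by)
  then show ?thesis using assms(3)
  proof induction
    case (Int a b) then show ?case by (auto intro: eventually_conj)
  next
    case (UN K) then show ?case by (blast intro: eventually_mono)
  next
    case (Basis s)
    then obtain f U where "s = f -` U" "bounded_linear f" "open (U::real set)" by blast
    then show ?case using Basis(2) assms(1)
      by (auto simp: weak_converges_def tendsto_def)
  qed simp
qed

lemma weak_converges_of_tendsto:
  assumes "xs \<longlonglongrightarrow> x"
  shows "weak_converges xs x"
  using assms by (auto simp: weak_converges_def intro: bounded_linear.tendsto)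

lemma openin_weak_topology_Collect:
  assumes "bounded_linear f" "open (U::real set)"
  shows "openin weak_topology {x. f x \<in> U}"
  unfolding weak_topology_def
  by (rule topology_generated_by_Basis) (use assms in \<open>auto simp: vimage_def\<close>)

text \<open>Orbit points that almost norm \<open>h\<close> have values tending to 1, and exposedness
  of \<open>x\<close> turns this into weak convergence.\<close>

lemma weakly_exposed_orbit_sequence:
  fixes x y :: "'a::real_normed_vector"
  assumes ct: "convex_transitive TYPE('a)" and x: "weakly_exposed_by x h" and "norm y = 1"
  obtains T where "\<And>n. T n \<in> isometry_group" "weak_converges (\<lambda>n. T n y) x"
    "(\<lambda>n. h (T n y)) \<longlonglongrightarrow> 1"
proof -
  have h: "h \<in> dual_sphere" using x by (simp add: weakly_exposed_by_def)
  have "\<forall>n. \<exists>T\<in>isometry_group. 1 - inverse (real (Suc n)) < h (T y)"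
    using convex_transitive_functional[OF ct h assms(3)] by simp
  then obtain T where T: "\<And>n. T n \<in> isometry_group"
      and hT: "\<And>n. 1 - inverse (real (Suc n)) < h (T n y)" by metis
  have nT: "norm (T n y) = 1" for n using T[of n] assms(3) by (auto simp: isometry_group_def)
  have "(\<lambda>n. h (T n y)) \<longlonglongrightarrow> 1"
  proof (rule tendsto_sandwich)
    show "(\<lambda>n. 1 - inverse (real (Suc n))) \<longlonglongrightarrow> 1"
      using tendsto_diff[OF tendsto_const[of 1] LIMSEQ_inverse_real_of_nat] by simp
    show "\<forall>\<^sub>F n in sequentially. h (T n y) \<le> 1"
      using dual_sphere_le_norm[OF h, of "T _ y"] nT by (intro always_eventually allI) (metis abs_le_D1)
  qed (use hT in \<open>auto intro!: always_eventually less_imp_le\<close>)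
  moreover from this have "weak_converges (\<lambda>n. T n y) x"
    using x nT by (simp add: weakly_exposed_by_def)
  ultimately show thesis using that T by blast
qed

text \<open>The definition of \<open>weakly_exposed_by\<close> does not state this. It follows
  because isometric images of \<open>x\<close> itself converge weakly to \<open>x\<close> while
  their values under \<open>h\<close> tend to 1.\<close>

lemma weakly_exposed_by_self:
  fixes x :: "'a::real_normed_vector"
  assumes "convex_transitive TYPE('a)" "weakly_exposed_by x h"
  shows "h x = 1"
proof -
  have nx: "norm x = 1" and bl: "bounded_linear h"
    using assms(2) by (auto simp: weakly_exposed_by_def dual_sphere_def)
  obtain T where "weak_converges (\<lambda>n. T n x) x" "(\<lambda>n. h (T n x)) \<longlonglongrightarrow> 1"
    by (rule weakly_exposed_orbit_sequence[OF assms nx])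
  then show ?thesis using bl by (auto simp: weak_converges_def intro: LIMSEQ_unique)
qed

text \<open>Exposing functionals are norming: one that exposes a point close to
  \<open>v /\<^sub>R norm v\<close> has a value close to \<open>norm v\<close> at \<open>v\<close>.
  This lets norm bounds survive weak limits.\<close>

lemma norm_le_by_exposing_functionals:
  fixes v :: "'a::real_normed_vector"
  assumes ct: "convex_transitive TYPE('a)"
    and dense: "sphere 0 1 \<subseteq> closure (weakly_exposed_points :: 'a set)"
    and "0 \<le> c" and le: "\<And>x h. weakly_exposed_by x h \<Longrightarrow> h v \<le> c"
  shows "norm v \<le> c"
proof (rule ccontr)
  assume "\<not> norm v \<le> c"
  then have c: "c < norm v" and v: "norm v > 0" using \<open>0 \<le> c\<close> by auto
  have "v /\<^sub>R norm v \<in> closure weakly_exposed_points" using dense v by auto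
  \<comment> \<open>A point this close to \<open>v /\<^sub>R norm v\<close>, where \<open>h\<close>
    takes the value 1, keeps \<open>h\<close> above \<open>c / norm v\<close> at
    \<open>v /\<^sub>R norm v\<close>.\<close>
  moreover have "0 < 1 - c / norm v" using c v by simp
  ultimately obtain x where "x \<in> weakly_exposed_points" and dx: "dist x (v /\<^sub>R norm v) < 1 - c / norm v"
    by (meson closure_approachable)
  then obtain h where h: "weakly_exposed_by x h" by (auto simp: weakly_exposed_points_def)
  then have hd: "h \<in> dual_sphere" and lin: "linear h"
    by (auto simp: weakly_exposed_by_def dual_sphere_def bounded_linear.linear)
  have "h x - h (v /\<^sub>R norm v) \<le> norm (x - v /\<^sub>R norm v)"
    using dual_sphere_le_norm[OF hd, of "x - v /\<^sub>R norm v"] by (simp add: linear_diff[OF lin])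
  then have "c / norm v < h v / norm v"
    using dx weakly_exposed_by_self[OF ct h]
    by (simp add: dist_norm linear_scale[OF lin] divide_inverse_commute)
  then show False using le[OF h] v by (simp add: divide_simps)
qed

section \<open>Weak-star limits of functionals\<close>

text \<open>A form of Banach-Alaoglu: by Tychonoff the product of the intervals
  \<open>{- norm v..norm v}\<close> is compact, so the functionals have a pointwise cluster point.
  The finer filter \<open>F\<close> plays the part of a subnet.\<close>

lemma functionals_cluster:
  fixes \<phi> :: "'i \<Rightarrow> 'a::real_normed_vector \<Rightarrow> real"
  assumes "F0 \<noteq> bot" and lin: "\<And>n. linear (\<phi> n)" and bd: "\<And>n v. \<bar>\<phi> n v\<bar> \<le> norm v"
  obtains F \<psi> where "F \<le> F0" "F \<noteq> bot" "\<And>v. ((\<lambda>n. \<phi> n v) \<longlongrightarrow> \<psi> v) F"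
    "linear \<psi>" "\<And>v. \<bar>\<psi> v\<bar> \<le> norm v"
proof -
  let ?K = "PiE UNIV (\<lambda>v::'a. {- norm v..norm v})"
  have "compactin (product_topology (\<lambda>v::'a. euclidean) UNIV) ?K"
    by (subst compactin_PiE) auto
  then have "compact ?K" by (simp add: euclidean_product_topology)
  moreover have "eventually (\<lambda>g. g \<in> ?K) (filtermap \<phi> F0)"
    using bd by (auto simp: eventually_filtermap abs_le_iff minus_le_iff intro!: always_eventually)
  moreover have "filtermap \<phi> F0 \<noteq> bot" using \<open>F0 \<noteq> bot\<close> by (simp add: filtermap_bot_iff)
  ultimately have "\<exists>\<psi>\<in>?K. inf (nhds \<psi>) (filtermap \<phi> F0) \<noteq> bot"
    using compact_filter[of ?K] by simp
  then obtain \<psi> where "inf (nhds \<psi>) (filtermap \<phi> F0) \<noteq> bot" ..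
  then have cl: "\<not> (\<exists>A B. eventually A (nhds \<psi>) \<and> eventually (\<lambda>n. B (\<phi> n)) F0 \<and> (\<forall>g. A g \<longrightarrow> \<not> B g))"
    by (simp add: trivial_limit_def eventually_inf eventually_filtermap)
  have ne: "inf (filtercomap \<phi> (nhds \<psi>)) F0 \<noteq> bot" (is "?F \<noteq> bot")
  proof
    assume "?F = bot"
    then obtain A B where A: "eventually A (nhds \<psi>)" and B: "eventually B F0"
        and AB: "\<And>n. A (\<phi> n) \<Longrightarrow> \<not> B n"
      unfolding trivial_limit_def eventually_inf eventually_filtercomap by blast
    \<comment> \<open>\<open>\<phi>\<close> need not be injective, so the index predicate
      \<open>B\<close> is pushed forward to a predicate on functionals.\<close>
    have "eventually (\<lambda>n. \<exists>m. \<phi> n = \<phi> m \<and> B m) F0"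
      using B by (rule eventually_mono) blast
    moreover have "\<forall>g. A g \<longrightarrow> \<not> (\<exists>m. g = \<phi> m \<and> B m)" using AB by blast
    ultimately have "\<exists>A B. eventually A (nhds \<psi>) \<and> eventually (\<lambda>n. B (\<phi> n)) F0 \<and> (\<forall>g. A g \<longrightarrow> \<not> B g)"
      using A by (intro exI[of _ A] exI[of _ "\<lambda>g. \<exists>m. g = \<phi> m \<and> B m"] conjI)
    with cl show False by contradiction
  qed
  have lim\<phi>: "filterlim \<phi> (nhds \<psi>) ?F"
    by (rule filterlim_mono[OF filterlim_filtercomap order_refl inf_le1])
  have coord: "((\<lambda>g. g v) \<longlongrightarrow> \<psi> v) (nhds \<psi>)" for v
  proof (rule topological_tendstoI)
    fix S :: "real set" assume "open S" "\<psi> v \<in> S"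
    then have "open ((\<lambda>g::'a \<Rightarrow> real. g v) -` S)" "\<psi> \<in> (\<lambda>g. g v) -` S"
      by (auto intro: open_vimage)
    then show "\<forall>\<^sub>F g in nhds \<psi>. g v \<in> S"
      using eventually_nhds_in_open by fastforce
  qed
  have lim: "((\<lambda>n. \<phi> n v) \<longlongrightarrow> \<psi> v) ?F" for v
    using filterlim_compose[OF coord lim\<phi>] .
  have "linear \<psi>"
  proof (rule linearI)
    fix x y :: 'a and c :: real
    have "((\<lambda>n. \<phi> n (x + y)) \<longlongrightarrow> \<psi> x + \<psi> y) ?F"
      using tendsto_add[OF lim lim] by (simp add: linear_add[OF lin])
    then show "\<psi> (x + y) = \<psi> x + \<psi> y" using tendsto_unique[OF ne lim] by blast
    have "((\<lambda>n. \<phi> n (c *\<^sub>R x)) \<longlongrightarrow> c *\<^sub>R \<psi> x) ?F"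
      using tendsto_scaleR[OF tendsto_const lim] by (simp add: linear_scale[OF lin])
    then show "\<psi> (c *\<^sub>R x) = c *\<^sub>R \<psi> x" using tendsto_unique[OF ne lim] by blast
  qed
  moreover have "\<bar>\<psi> v\<bar> \<le> norm v" for v
    using tendsto_upperbound[OF tendsto_rabs[OF lim] always_eventually ne] bd by blast
  ultimately show thesis using that[of ?F \<psi>] lim ne by simp
qed

section \<open>Contractive projections in every direction\<close>

text \<open>With \<open>\<phi> x = 1\<close> and \<open>norm x = 1\<close> this describes a
  bicontractive projection onto the line of \<open>x\<close>. It is encoded by its functional
  because the limits taken later are weak-star limits of functionals.\<close>

definition contractive_pair :: "'a::real_normed_vector \<Rightarrow> ('a \<Rightarrow> real) \<Rightarrow> bool" where
  "contractive_pair x \<phi> \<longleftrightarrow> linear \<phi> \<and> (\<forall>v. \<bar>\<phi> v\<bar> \<le> norm v) \<and> (\<forall>v. norm (v - \<phi> v *\<^sub>R x) \<le> norm v)"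

text \<open>Along a finer filter the scalars \<open>\<phi> n v\<close> converge and the
  \<open>xs n\<close> converge weakly, so \<open>v - \<phi> n v *\<^sub>R xs n\<close> converges
  weakly and exposing functionals carry the bound over. A normalisation of
  \<open>\<phi> n (xs n)\<close> need not pass to the limit; hence the hypothesis on
  \<open>\<phi> n x\<close>.\<close>

lemma contractive_pair_limit:
  fixes x :: "'a::real_normed_vector"
  assumes ct: "convex_transitive TYPE('a)"
    and dense: "sphere 0 1 \<subseteq> closure (weakly_exposed_points :: 'a set)"
    and pair: "\<And>n. contractive_pair (xs n) (\<phi> n)"
    and xs: "weak_converges xs x" and one: "(\<lambda>n. \<phi> n x) \<longlonglongrightarrow> 1"
  obtains \<psi> where "contractive_pair x \<psi>" "\<psi> x = 1"
proof -
  have lin: "\<And>n. linear (\<phi> n)" and bd: "\<And>n v. \<bar>\<phi> n v\<bar> \<le> norm v"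
    and con: "\<And>n v. norm (v - \<phi> n v *\<^sub>R xs n) \<le> norm v"
    using pair by (auto simp: contractive_pair_def)
  obtain F \<psi> where F: "F \<le> sequentially" "F \<noteq> bot" and lim: "\<And>v. ((\<lambda>n. \<phi> n v) \<longlongrightarrow> \<psi> v) F"
    and \<psi>: "linear \<psi>" "\<And>v. \<bar>\<psi> v\<bar> \<le> norm v"
    by (rule functionals_cluster[of sequentially \<phi>, OF trivial_limit_sequentially lin bd]) (rule that)
  have "\<psi> x = 1"
    using tendsto_unique[OF F(2) lim tendsto_mono[OF F(1) one]] .
  moreover have "norm (v - \<psi> v *\<^sub>R x) \<le> norm v" for v
  proof (rule norm_le_by_exposing_functionals[OF ct dense norm_ge_zero])
    fix y h assume h: "weakly_exposed_by (y::'a) h"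
    then have hd: "h \<in> dual_sphere" and bl: "bounded_linear h"
      by (auto simp: weakly_exposed_by_def dual_sphere_def)
    then have hl: "linear h" by (simp add: bounded_linear.linear)
    have "((\<lambda>n. h (xs n)) \<longlongrightarrow> h x) F"
      using xs bl F(1) by (auto simp: weak_converges_def intro: tendsto_mono)
    then have "((\<lambda>n. h (v - \<phi> n v *\<^sub>R xs n)) \<longlongrightarrow> h (v - \<psi> v *\<^sub>R x)) F"
      by (simp add: linear_diff[OF hl] linear_scale[OF hl]) (intro tendsto_intros lim)
    moreover have "h (v - \<phi> n v *\<^sub>R xs n) \<le> norm v" for n
      using dual_sphere_le_norm[OF hd, of "v - \<phi> n v *\<^sub>R xs n"] con[of v n] by linarith
    ultimately show "h (v - \<psi> v *\<^sub>R x) \<le> norm v"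
      using F(2) by (auto intro: tendsto_upperbound always_eventually)
  qed
  ultimately show thesis using that \<psi> by (auto simp: contractive_pair_def)
qed

lemma bicontractive_contractive_pair:
  assumes u: "norm u = 1" and P: "projection_onto P (span {u})" "bicontractive P"
  obtains f where "contractive_pair u f" "f u = 1"
proof -
  have lin: "linear P" and idem: "\<And>x. P (P x) = P x" and ran: "range P = span {u}"
    using P(1) by (auto simp: projection_onto_def)
  have bl: "bounded_linear P" and o1: "onorm P \<le> 1" and o2: "onorm (\<lambda>x. x - P x) \<le> 1"
    using P(2) by (auto simp: bicontractive_def)
  have "P x \<in> span {u}" for x using ran by blast
  then have "\<exists>c. P x = c *\<^sub>R u" for x by (auto simp: span_singleton)
  then obtain f where f: "\<And>x. P x = f x *\<^sub>R u" by metis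
  have "u \<noteq> 0" using u by auto
  have "linear f"
    using lin \<open>u \<noteq> 0\<close> by (intro linearI)
      (metis f linear_add scaleR_left.add scaleR_cancel_right, metis f linear_scale scaleR_scaleR scaleR_cancel_right real_scaleR_def)
  moreover have "\<bar>f v\<bar> \<le> norm v" for v
    using onorm[OF bl, of v] o1 u mult_right_mono[OF o1 norm_ge_zero[of v]] by (simp add: f)
  moreover have "norm (v - f v *\<^sub>R u) \<le> norm v" for v
    using onorm[OF bounded_linear_sub[OF bounded_linear_ident bl], of v]
      mult_right_mono[OF o2 norm_ge_zero[of v]] by (simp add: f)
  moreover have "f u = 1"
  proof -
    have "u \<in> range P" unfolding ran by (simp add: span_base)
    then have "P u = u" using idem by auto
    then show ?thesis using f[of u] \<open>u \<noteq> 0\<close> by (metis scaleR_cancel_right scaleR_one)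
  qed
  ultimately show thesis using that by (auto simp: contractive_pair_def)
qed

text \<open>This is the pair of the conjugated projection: apply \<open>f \<otimes> u\<close>
  between \<open>T\<close> and \<open>inv T\<close>.\<close>

lemma contractive_pair_isometry:
  assumes "contractive_pair u f" "T \<in> isometry_group"
  shows "contractive_pair (inv T u) (f \<circ> T)"
proof -
  have T: "linear T" "\<And>x. norm (T x) = norm x"
    using assms(2) by (auto simp: isometry_group_def)
  have "norm (v - f (T v) *\<^sub>R inv T u) \<le> norm v" for v
  proof -
    have "norm (v - f (T v) *\<^sub>R inv T u) = norm (T (v - f (T v) *\<^sub>R inv T u))" by (simp add: T)
    also have "\<dots> = norm (T v - f (T v) *\<^sub>R u)"
      by (simp add: linear_diff[OF T(1)] linear_scale[OF T(1)] isometry_group_inv[OF assms(2)])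
    also have "\<dots> \<le> norm v" using assms(1) T(2) unfolding contractive_pair_def by metis
    finally show ?thesis .
  qed
  then show ?thesis
    using assms le_norm_comp_isometry[OF assms(2), of f] by (auto simp: contractive_pair_def)
qed

text \<open>The isometries are chosen so that \<open>T n x\<close> approaches \<open>u\<close> weakly: upper semicontinuity then turns
  the exposing functional \<open>h\<close> of \<open>x\<close> into the statement that \<open>inv (T n) u\<close> approaches \<open>x\<close> weakly.\<close>

lemma weakly_exposed_contractive_pair:
  fixes x u :: "'a::real_normed_vector"
  assumes ct: "convex_transitive TYPE('a)"
    and dense: "sphere 0 1 \<subseteq> closure (weakly_exposed_points :: 'a set)"
    and usc: "usc_at (subtopology weak_topology (sphere (0::'a) 1))
               (\<lambda>x. (\<lambda>g. g u) ` duality_map x) u"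
    and u: "norm u = 1" and f: "contractive_pair u f" "f u = 1" and x: "weakly_exposed_by x h"
  obtains \<psi> where "contractive_pair x \<psi>" "\<psi> x = 1"
proof -
  have nx: "norm x = 1" and h: "h \<in> dual_sphere" using x by (auto simp: weakly_exposed_by_def)
  have hl: "linear h" using h by (auto simp: dual_sphere_def bounded_linear.linear)
  have fl: "linear f" "\<And>v. \<bar>f v\<bar> \<le> norm v" using f by (auto simp: contractive_pair_def)
  have "\<exists>T\<in>isometry_group. 1 - e < h (inv T u) \<and> 1 - e < f (T x)" if "0 < e" for e
  proof -
    \<comment> \<open>Every support functional of \<open>u\<close> takes the value 1 at
      \<open>u\<close>, so this half-line is an admissible neighbourhood for upper
      semicontinuity.\<close>
    have "(\<lambda>g. g u) ` duality_map u \<subseteq> {1 - e<..}" using that by (auto simp: duality_map_def)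
    then obtain U where U: "openin (subtopology weak_topology (sphere (0::'a) 1)) U" "u \<in> U"
      and "\<forall>s\<in>U. (\<lambda>g. g u) ` duality_map s \<subseteq> {1 - e<..}"
      using usc[unfolded usc_at_def, rule_format, of "{1 - e<..}"] by auto
    then have Ug: "\<And>s g. s \<in> U \<Longrightarrow> g \<in> duality_map s \<Longrightarrow> 1 - e < g u" by fastforce
    from U obtain W where W: "openin weak_topology W" "U = W \<inter> sphere 0 1"
      by (auto simp: openin_subtopology)
    \<comment> \<open>The second condition secures that \<open>f (T x)\<close> is close to 1 for the
      isometry found below.\<close>
    define W' where "W' = W \<inter> {y. f y \<in> {1 - e<..}}"
    have W': "openin weak_topology W'" "u \<in> W'"
      unfolding W'_def using W U(2) f(2) that
        openin_weak_topology_Collect[OF bounded_linear_of_le_norm[OF fl] open_greaterThan, of "1 - e"] by auto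
    \<comment> \<open>\<open>u\<close> itself need not be exposed. An exposed \<open>w n\<close>
      enters \<open>W'\<close> first, and then the orbit of \<open>x\<close>, which approaches
      \<open>w n\<close> weakly, enters it too.\<close>
    have "u \<in> closure weakly_exposed_points" using dense u by auto
    then obtain w where w: "\<And>n. w n \<in> weakly_exposed_points" "w \<longlonglongrightarrow> u"
      by (auto simp: closure_sequential)
    then obtain n where "w n \<in> W'"
      using weak_converges_eventually[OF weak_converges_of_tendsto[OF w(2)] W'] by (auto simp: eventually_sequentially)
    moreover obtain k where k: "weakly_exposed_by (w n) k" using w(1) by (auto simp: weakly_exposed_points_def)
    moreover obtain S where S: "\<And>n. S n \<in> isometry_group" "weak_converges (\<lambda>n. S n x) (w n)"
      by (rule weakly_exposed_orbit_sequence[OF ct k nx]) (rule that)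
    ultimately obtain m where "S m x \<in> W'"
      using weak_converges_eventually[OF S(2) W'(1)] by (auto simp: eventually_sequentially)
    with S(1) obtain T where T: "T \<in> isometry_group" "T x \<in> W'" by blast
    note Ti = isometry_group_inv[OF T(1)]
    have nTx: "norm (T x) = 1" using T(1) nx by (auto simp: isometry_group_def)
    have hT: "linear (h \<circ> inv T)" "\<And>v. \<bar>(h \<circ> inv T) v\<bar> \<le> norm v"
      using le_norm_comp_isometry[OF Ti(1) hl dual_sphere_le_norm[OF h]] by auto
    \<comment> \<open>Since \<open>h x = 1\<close>, the transported functional supports
      \<open>T x\<close>; upper semicontinuity then bounds its value at \<open>u\<close>.\<close>
    have "h \<circ> inv T \<in> duality_map (T x)"
      using dual_sphereI[OF hT nTx] weakly_exposed_by_self[OF ct x]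
      by (simp add: duality_map_def Ti) (simp add: comp_def)
    then have "1 - e < h (inv T u)" using Ug[of "T x" "h \<circ> inv T"] T(2) W(2) nTx by (auto simp: W'_def)
    then show ?thesis using T by (auto simp: W'_def)
  qed
  then have "\<forall>n. \<exists>T\<in>isometry_group. 1 - inverse (real (Suc n)) < h (inv T u) \<and> 1 - inverse (real (Suc n)) < f (T x)"
    by simp
  then obtain T where T: "\<And>n. T n \<in> isometry_group"
    and hT: "\<And>n. 1 - inverse (real (Suc n)) < h (inv (T n) u)"
    and fT: "\<And>n. 1 - inverse (real (Suc n)) < f (T n x)" by metis
  have to1: "s \<longlonglongrightarrow> 1" if "\<And>n. 1 - inverse (real (Suc n)) < s n" "\<And>n. s n \<le> 1" for s
    by (rule tendsto_sandwich[of "\<lambda>n. 1 - inverse (real (Suc n))" s _ "\<lambda>_. 1"])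
       (use that tendsto_diff[OF tendsto_const[of 1] LIMSEQ_inverse_real_of_nat]
         in \<open>auto intro!: always_eventually less_imp_le\<close>)
  have nT: "norm (T n x) = 1" "norm (inv (T n) u) = 1" for n
    using T[of n] isometry_group_inv(1)[OF T[of n]] nx u by (auto simp: isometry_group_def)
  have "(\<lambda>n. h (inv (T n) u)) \<longlonglongrightarrow> 1"
    using hT dual_sphere_le_norm[OF h] nT(2) by (intro to1) (auto, metis abs_le_D1)
  then have "weak_converges (\<lambda>n. inv (T n) u) x"
    using x nT(2) by (simp add: weakly_exposed_by_def)
  moreover have "(\<lambda>n. (f \<circ> T n) x) \<longlonglongrightarrow> 1"
    using fT fl(2) nT(1) by (intro to1) (auto, metis abs_le_D1)
  ultimately obtain \<psi> where "contractive_pair x \<psi>" "\<psi> x = 1"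
    by (rule contractive_pair_limit[OF ct dense contractive_pair_isometry[OF f(1) T]])
  then show thesis by (rule that)
qed

text \<open>Exposed points \<open>w n\<close> tend to \<open>x\<close> in norm. Their functionals
  satisfy \<open>\<phi> n (w n) = 1\<close> and are 1-Lipschitz, so \<open>\<phi> n x\<close> tends
  to 1 and the limit lemma applies.\<close>

lemma unit_vector_contractive_pair:
  fixes x u :: "'a::real_normed_vector"
  assumes ct: "convex_transitive TYPE('a)"
    and dense: "sphere 0 1 \<subseteq> closure (weakly_exposed_points :: 'a set)"
    and usc: "usc_at (subtopology weak_topology (sphere (0::'a) 1))
               (\<lambda>x. (\<lambda>g. g u) ` duality_map x) u"
    and u: "norm u = 1" and f: "contractive_pair u f" "f u = 1" and x: "norm x = 1"
  obtains \<psi> where "contractive_pair x \<psi>" "\<psi> x = 1"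
proof -
  have "x \<in> closure weakly_exposed_points" using dense x by auto
  then obtain w where w: "\<And>n. w n \<in> weakly_exposed_points" "w \<longlonglongrightarrow> x"
    by (auto simp: closure_sequential)
  have "\<exists>\<psi>. contractive_pair (w n) \<psi> \<and> \<psi> (w n) = 1" for n
  proof -
    obtain h where "weakly_exposed_by (w n) h" using w(1) by (auto simp: weakly_exposed_points_def)
    then show ?thesis by (rule weakly_exposed_contractive_pair[OF ct dense usc u f]) blast
  qed
  then obtain \<phi> where \<phi>: "\<And>n. contractive_pair (w n) (\<phi> n)" "\<And>n. \<phi> n (w n) = 1" by metis
  have *: "\<bar>\<phi> n x - 1\<bar> \<le> norm (w n - x)" for n
    using \<phi>[of n] unfolding contractive_pair_def
    by (metis abs_minus_commute linear_diff)
  have "(\<lambda>n. norm (w n - x)) \<longlonglongrightarrow> 0"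
    using w(2) by (simp add: LIM_zero tendsto_norm_zero)
  then have "(\<lambda>n. \<phi> n x - 1) \<longlonglongrightarrow> 0"
    by (rule Lim_null_comparison[rotated]) (simp add: *)
  then have "(\<lambda>n. \<phi> n x) \<longlonglongrightarrow> 1" by (simp add: LIM_zero_iff)
  then obtain \<psi> where "contractive_pair x \<psi>" "\<psi> x = 1"
    by (rule contractive_pair_limit[OF ct dense \<phi>(1) weak_converges_of_tendsto[OF w(2)]])
  then show thesis by (rule that)
qed

section \<open>Smoothness\<close>

text \<open>If \<open>y\<close> had two support functionals \<open>g\<^sub>1\<close>, \<open>g\<^sub>2\<close>, the norm would be constant in direction \<open>y\<close> on the open
  cone \<open>{g\<^sub>1 > 0 > g\<^sub>2}\<close>, which contains an exposed point.\<close>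

lemma support_functional_unique:
  fixes y :: "'a::real_normed_vector"
  assumes ct: "convex_transitive TYPE('a)"
    and dense: "sphere 0 1 \<subseteq> closure (weakly_exposed_points :: 'a set)"
    and pairs: "\<And>x::'a. norm x = 1 \<Longrightarrow> \<exists>\<psi>. contractive_pair x \<psi> \<and> \<psi> x = 1"
    and y: "norm y = 1"
    and g1: "linear g1" "\<And>v. \<bar>g1 v\<bar> \<le> norm v" "g1 y = 1"
    and g2: "linear g2" "\<And>v. \<bar>g2 v\<bar> \<le> norm v" "g2 y = 1"
  shows "g1 v \<le> g2 v"
proof (rule ccontr)
  assume "\<not> ?thesis"
  then have gv: "g2 v < g1 v" by simp
  define U where "U = {x. 0 < g1 x} \<inter> {x. g2 x < 0}"
  have "open {x. 0 < g1 x}" "open {x. g2 x < 0}"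
    using bounded_linear_of_le_norm[OF g1(1,2)] bounded_linear_of_le_norm[OF g2(1,2)]
    by (auto intro!: open_Collect_less linear_continuous_on continuous_on_const)
  then have openU: "open U" unfolding U_def by (rule open_Int)
  \<comment> \<open>Subtracting the mean of the two values leaves \<open>g1 z = - g2 z > 0\<close>,
    so the cone is nonempty.\<close>
  define z where "z = v - ((g1 v + g2 v) / 2) *\<^sub>R y"
  have "g1 z = (g1 v - g2 v) / 2" "g2 z = (g2 v - g1 v) / 2"
    unfolding z_def using g1(3) g2(3)
    by (simp_all add: linear_diff[OF g1(1)] linear_scale[OF g1(1)] linear_diff[OF g2(1)] linear_scale[OF g2(1)] field_simps)
  then have gz: "0 < g1 z" "g2 z < 0" using gv by auto
  then have "z \<noteq> 0" using linear_0[OF g1(1)] by auto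
  have "z /\<^sub>R norm z \<in> U" using gz \<open>z \<noteq> 0\<close>
    by (auto simp: U_def linear_scale[OF g1(1)] linear_scale[OF g2(1)] mult_pos_neg)
  moreover have "z /\<^sub>R norm z \<in> closure weakly_exposed_points" using dense \<open>z \<noteq> 0\<close> by auto
  ultimately obtain w where w: "w \<in> U" "w \<in> weakly_exposed_points"
    using openU by (meson closure_iff_nhds_not_empty disjoint_iff open_Int_closure_eq_empty subset_refl)
  then obtain h where h: "weakly_exposed_by w h" by (auto simp: weakly_exposed_points_def)
  then have nw: "norm w = 1" and hd: "h \<in> dual_sphere" by (auto simp: weakly_exposed_by_def)
  then have hl: "linear h" by (auto simp: dual_sphere_def bounded_linear.linear)
  \<comment> \<open>The contraction moves \<open>y\<close> to \<open>y - t x\<close> of norm at most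
    1, with \<open>t = \<phi> y / norm x\<close>. Testing with \<open>g1\<close> and
    \<open>g2\<close> gives \<open>t * g1 x \<ge> 0\<close> and \<open>t * g2 x \<ge> 0\<close>; the
    opposite signs of \<open>g1 x\<close> and \<open>g2 x\<close> force
    \<open>t = 0\<close>.\<close>
  have zero: "\<exists>\<phi>. linear \<phi> \<and> (\<forall>v. \<bar>\<phi> v\<bar> \<le> norm v) \<and> \<phi> x = norm x \<and> \<phi> y = 0" if "x \<in> U" for x
  proof -
    have x0: "0 < norm x" using that linear_0[OF g1(1)] by (auto simp: U_def)
    then obtain \<phi> where \<phi>: "contractive_pair (x /\<^sub>R norm x) \<phi>" "\<phi> (x /\<^sub>R norm x) = 1"
      using pairs[of "x /\<^sub>R norm x"] by auto
    then have pl: "linear \<phi>" "\<And>v. \<bar>\<phi> v\<bar> \<le> norm v" by (auto simp: contractive_pair_def)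
    have "norm (y - \<phi> y *\<^sub>R (x /\<^sub>R norm x)) \<le> norm y" using \<phi>(1) unfolding contractive_pair_def by blast
    then have con: "norm (y - (\<phi> y / norm x) *\<^sub>R x) \<le> 1" using y by (simp add: divide_inverse)
    have "g1 (y - (\<phi> y / norm x) *\<^sub>R x) \<le> 1" "g2 (y - (\<phi> y / norm x) *\<^sub>R x) \<le> 1"
      using con g1(2)[of "y - (\<phi> y / norm x) *\<^sub>R x"] g2(2)[of "y - (\<phi> y / norm x) *\<^sub>R x"] by linarith+
    then have "0 \<le> (\<phi> y / norm x) * g1 x" "0 \<le> (\<phi> y / norm x) * g2 x"
      using g1(3) g2(3) by (simp_all add: linear_diff[OF g1(1)] linear_scale[OF g1(1)] linear_diff[OF g2(1)] linear_scale[OF g2(1)])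
    moreover have "0 < g1 x" "g2 x < 0" using that by (auto simp: U_def)
    ultimately have "\<phi> y / norm x = 0"
      by (metis linorder_not_less mult_pos_neg not_less_iff_gr_or_eq mult_less_0_iff)
    then have "\<phi> y = 0" using x0 by simp
    moreover have "\<phi> x = norm x"
      using \<phi>(2) x0 by (simp add: linear_scale[OF pl(1)] divide_simps)
    ultimately show ?thesis using pl by blast
  qed
  have mono: "norm (w + s *\<^sub>R y) \<le> norm (w + t *\<^sub>R y)" if sU: "w + s *\<^sub>R y \<in> U" for s t
  proof -
    obtain \<phi> where \<phi>: "linear \<phi>" "\<And>v. \<bar>\<phi> v\<bar> \<le> norm v" "\<phi> (w + s *\<^sub>R y) = norm (w + s *\<^sub>R y)" "\<phi> y = 0"
      using zero[OF sU] by blast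
    have "norm (w + s *\<^sub>R y) = \<phi> (w + t *\<^sub>R y)"
      using \<phi>(3,4) by (simp add: linear_add[OF \<phi>(1)] linear_scale[OF \<phi>(1)])
    also have "\<dots> \<le> norm (w + t *\<^sub>R y)" using \<phi>(2) abs_le_D1 by blast
    finally show ?thesis .
  qed
  obtain e where e: "0 < e" "ball w e \<subseteq> U" using openU w(1) by (auto simp: open_contains_ball)
  define d where "d = e / 2"
  have d: "0 < d" using e by (simp add: d_def)
  have "w + d *\<^sub>R y \<in> ball w e" "w + (- d) *\<^sub>R y \<in> ball w e"
    using e(1) y by (auto simp: d_def dist_norm)
  then have "w + d *\<^sub>R y \<in> U" "w + (- d) *\<^sub>R y \<in> U" using e(2) by blast+
  then have "norm (w + d *\<^sub>R y) \<le> 1" "norm (w + (- d) *\<^sub>R y) \<le> 1"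
    using mono[of d 0] mono[of "- d" 0] nw by simp_all
  then have le: "h (w + d *\<^sub>R y) \<le> 1" "h (w + (- d) *\<^sub>R y) \<le> 1" "norm (w + d *\<^sub>R y) \<le> 1"
    using dual_sphere_le_norm[OF hd, of "w + d *\<^sub>R y"] dual_sphere_le_norm[OF hd, of "w + (- d) *\<^sub>R y"] by linarith+
  have "h y = 0"
    using le(1,2) d weakly_exposed_by_self[OF ct h]
    by (simp add: linear_add[OF hl] linear_diff[OF hl] linear_scale[OF hl] linear_neg[OF hl] mult_le_0_iff zero_le_mult_iff)
  then have "h (w + d *\<^sub>R y) = 1"
    using weakly_exposed_by_self[OF ct h] by (simp add: linear_add[OF hl] linear_scale[OF hl])
  \<comment> \<open>The constant sequence meets the exposing condition, so it converges weakly to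
    \<open>w\<close>, yet \<open>g1\<close> separates its value from \<open>w\<close>.\<close>
  then have "weak_converges (\<lambda>_. w + d *\<^sub>R y) w"
    using h le(3) by (simp add: weakly_exposed_by_def)
  then have "g1 (w + d *\<^sub>R y) = g1 w"
    using bounded_linear_of_le_norm[OF g1(1,2)] by (auto simp: weak_converges_def LIMSEQ_const_iff)
  then show False using d g1(3) by (simp add: linear_add[OF g1(1)] linear_scale[OF g1(1)])
qed

section \<open>Symmetric orthogonality\<close>

text \<open>\<open>D_contraction\<close> comes from the contractive pairs and
  \<open>D_unique\<close> is smoothness. The convention \<open>D 0 = 0\<close> makes the zero vector
  orthogonal to everything on both sides.\<close>

locale symmetric_duality =
  fixes D :: "'a::real_normed_vector \<Rightarrow> 'a \<Rightarrow> real"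
  assumes linear_D: "linear (D x)"
    and D_le: "\<bar>D x v\<bar> \<le> norm v"
    and D_self: "D x x = norm x"
    and D_zero: "D 0 v = 0"
    and D_contraction: "norm (v - (D x v / norm x) *\<^sub>R x) \<le> norm v"
    and D_unique: "x \<noteq> 0 \<Longrightarrow> linear g \<Longrightarrow> (\<And>v. \<bar>g v\<bar> \<le> norm v) \<Longrightarrow> g x = norm x \<Longrightarrow> g = D x"
begin

lemmas D_simps = linear_add[OF linear_D] linear_diff[OF linear_D] linear_scale[OF linear_D]
  linear_neg[OF linear_D] linear_0[OF linear_D]

text \<open>Apply \<open>D y\<close> to the contraction of \<open>y\<close> along \<open>x\<close>:
  the value \<open>norm y - D x y * D y x / norm x\<close> cannot exceed
  \<open>norm y\<close>.\<close>

lemma D_same_sign: "0 \<le> D x y * D y x"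
proof (cases "x = 0")
  case False
  have "D y (y - (D x y / norm x) *\<^sub>R x) \<le> norm y"
    using D_le[of y "y - (D x y / norm x) *\<^sub>R x"] D_contraction[of y x] by linarith
  then have "0 \<le> (D x y * D y x) / norm x" by (simp add: D_simps D_self)
  then show ?thesis using False by (simp add: zero_le_divide_iff)
qed (simp add: D_zero)

text \<open>Any cluster functional of \<open>D z\<close> as \<open>z\<close> tends to
  \<open>x\<close> supports \<open>x\<close>, so it equals \<open>D x\<close> by uniqueness. A
  failure of convergence would yield one that stays \<open>e\<close> away at
  \<open>v\<close>.\<close>

lemma tendsto_D:
  assumes "x \<noteq> 0"
  shows "((\<lambda>z. D z v) \<longlongrightarrow> D x v) (at x)"
proof (rule tendstoI, rule ccontr)
  fix e :: real assume e: "0 < e" and ne: "\<not> (\<forall>\<^sub>F z in at x. dist (D z v) (D x v) < e)"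
  let ?F0 = "inf (at x) (principal {z. e \<le> dist (D z v) (D x v)})"
  have "?F0 \<noteq> bot"
    using ne by (auto simp: trivial_limit_def eventually_inf_principal not_le)
  then obtain F \<psi> where F: "F \<le> ?F0" "F \<noteq> bot" and lim: "\<And>v. ((\<lambda>z. D z v) \<longlongrightarrow> \<psi> v) F"
    and \<psi>: "linear \<psi>" "\<And>v. \<bar>\<psi> v\<bar> \<le> norm v"
    by (rule functionals_cluster[of ?F0 D, OF _ linear_D D_le]) (rule that)
  have "F \<le> at x" and F2: "F \<le> principal {z. e \<le> dist (D z v) (D x v)}" using F(1) by auto
  then have Fx: "((\<lambda>z. z) \<longlongrightarrow> x) F" by (intro tendsto_mono[OF _ tendsto_ident_at])
  have "((\<lambda>z. norm (x - z) + norm (x - z)) \<longlongrightarrow> norm (x - x) + norm (x - x)) F"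
    by (intro tendsto_intros Fx)
  then have lim0: "((\<lambda>z. norm (x - z) + norm (x - z)) \<longlongrightarrow> 0) F" by simp
  have "norm (D z x - norm x) \<le> norm (x - z) + norm (x - z)" for z
  proof -
    have "D z x = norm z + D z (x - z)" by (simp add: D_simps D_self)
    then show ?thesis using D_le[of z "x - z"] norm_triangle_ineq3[of x z] by simp
  qed
  then have "((\<lambda>z. D z x - norm x) \<longlongrightarrow> 0) F"
    by (intro Lim_null_comparison[OF _ lim0]) simp
  then have "((\<lambda>z. D z x) \<longlongrightarrow> norm x) F" by (simp add: LIM_zero_iff)
  then have "\<psi> x = norm x" using tendsto_unique[OF F(2) lim] by blast
  then have "\<psi> = D x" using D_unique[OF assms \<psi>] by blast
  then have "eventually (\<lambda>z. dist (D z v) (D x v) < e) F" using tendstoD[OF lim e] by auto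
  moreover have "eventually (\<lambda>z. e \<le> dist (D z v) (D x v)) F"
    using F2 by (simp add: le_principal)
  ultimately have "eventually (\<lambda>z. False) F" by eventually_elim simp
  then show False using F(2) by simp
qed

text \<open>The subgradient inequalities at \<open>p s\<close> and at \<open>p t\<close> enclose the
  difference quotient of the norm between \<open>D (p s)\<close> and \<open>D (p t)\<close> of the
  quotient of \<open>p\<close>; both bounds converge by \<open>tendsto_D\<close>. Using
  \<open>min\<close> and \<open>max\<close> covers both signs of \<open>t - s\<close>.\<close>

lemma norm_has_derivative_along:
  assumes p: "(p has_vector_derivative p') (at s)" and "p s \<noteq> 0"
  shows "((\<lambda>t. norm (p t)) has_real_derivative D (p s) p') (at s)"
proof -
  define d where "d t = (p t - p s) /\<^sub>R (t - s)" for t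
  have "((\<lambda>t. norm ((p t - p s) - (t - s) *\<^sub>R p') / norm (t - s)) \<longlongrightarrow> 0) (at s)"
    using p by (simp add: has_vector_derivative_def has_derivative_iff_norm)
  moreover have "norm ((p t - p s) - (t - s) *\<^sub>R p') / norm (t - s) = norm (d t - p')" if "t \<noteq> s" for t
  proof -
    have "d t - p' = ((p t - p s) - (t - s) *\<^sub>R p') /\<^sub>R (t - s)"
      using that by (simp add: d_def scaleR_diff_right)
    then show ?thesis by (simp add: divide_inverse_commute)
  qed
  ultimately have d0: "((\<lambda>t. norm (d t - p')) \<longlongrightarrow> 0) (at s)"
    by (auto simp: eventually_at_filter elim!: Lim_transform_eventually)
  then have d: "(d \<longlongrightarrow> p') (at s)" by (simp add: tendsto_norm_zero_iff LIM_zero_iff)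
  have cont: "(p \<longlongrightarrow> p s) (at s)"
    using has_vector_derivative_continuous[OF p] by (simp add: continuous_at)
  have A: "((\<lambda>t. D (p s) (d t)) \<longlongrightarrow> D (p s) p') (at s)"
    using bounded_linear.tendsto[OF bounded_linear_of_le_norm[OF linear_D D_le] d] .
  have "isCont (\<lambda>z. D z p') (p s)" using tendsto_D[OF assms(2)] by (simp add: isCont_def)
  then have B1: "((\<lambda>t. D (p t) p') \<longlongrightarrow> D (p s) p') (at s)" using cont by (rule isCont_tendsto_compose)
  from d0 have "((\<lambda>t. D (p t) (d t - p')) \<longlongrightarrow> 0) (at s)"
    by (rule Lim_null_comparison[rotated]) (simp add: D_le)
  from tendsto_add[OF B1 this] have B: "((\<lambda>t. D (p t) (d t)) \<longlongrightarrow> D (p s) p') (at s)"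
    by (simp add: D_simps)
  have below: "D (p s) (p t - p s) \<le> norm (p t) - norm (p s)"
    and above: "norm (p t) - norm (p s) \<le> D (p t) (p t - p s)" for t
    using D_le[of "p s" "p t"] D_le[of "p t" "p s"] by (auto simp: D_simps D_self)
  have q: "min (D (p s) (d t)) (D (p t) (d t)) \<le> (norm (p t) - norm (p s)) / (t - s) \<and>
           (norm (p t) - norm (p s)) / (t - s) \<le> max (D (p s) (d t)) (D (p t) (d t))" if "t \<noteq> s" for t
  proof -
    have eq: "D z (d t) = D z (p t - p s) / (t - s)" for z by (simp add: d_def D_simps divide_inverse_commute)
    show ?thesis
    proof (cases "s < t")
      case True
      then have "0 \<le> t - s" by simp
      from divide_right_mono[OF below this] divide_right_mono[OF above this] show ?thesis
        unfolding eq by (simp add: min_le_iff_disj le_max_iff_disj)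
    next
      case False
      then have "t - s \<le> 0" by simp
      from divide_right_mono_neg[OF below this] divide_right_mono_neg[OF above this] show ?thesis
        unfolding eq by (simp add: min_le_iff_disj le_max_iff_disj)
    qed
  qed
  have "((\<lambda>t. (norm (p t) - norm (p s)) / (t - s)) \<longlongrightarrow> D (p s) p') (at s)"
  proof (rule tendsto_sandwich)
    show "((\<lambda>t. min (D (p s) (d t)) (D (p t) (d t))) \<longlongrightarrow> D (p s) p') (at s)" using tendsto_min[OF A B] by simp
    show "((\<lambda>t. max (D (p s) (d t)) (D (p t) (d t))) \<longlongrightarrow> D (p s) p') (at s)" using tendsto_max[OF A B] by simp
  qed (use q in \<open>auto simp: eventually_at_filter\<close>)
  then show ?thesis by (simp add: has_field_derivative_iff)
qed

lemma norm_has_derivative_line: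
  assumes "x \<noteq> 0"
  shows "((\<lambda>t. norm (x + t *\<^sub>R v)) has_real_derivative D x v) (at 0)"
proof -
  have "((\<lambda>t. x + t *\<^sub>R v) has_vector_derivative v) (at 0)"
    by (auto intro!: derivative_eq_intros)
  from norm_has_derivative_along[OF this] assms show ?thesis by simp
qed

text \<open>When \<open>D x y = 0\<close>, the contraction along \<open>x\<close> sends
  \<open>y + t *\<^sub>R x\<close> to \<open>y\<close>. Hence the norm is minimal at
  \<open>t = 0\<close> and its derivative \<open>D y x\<close> vanishes.\<close>

lemma orth_sym:
  assumes "D x y = 0"
  shows "D y x = 0"
proof (cases "x = 0 \<or> y = 0")
  case False
  have "norm (y + 0 *\<^sub>R x) \<le> norm (y + t *\<^sub>R x)" for t
    using D_contraction[of "y + t *\<^sub>R x" x] False assms by (simp add: D_simps D_self)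
  then show ?thesis
    using DERIV_local_min[OF norm_has_derivative_line[of y x], of 1] False by simp
qed (auto simp: D_zero D_simps)

lemma orth_scale: "D x y = 0 \<Longrightarrow> D (a *\<^sub>R x) (b *\<^sub>R y) = 0"
  by (metis D_simps(3) mult_zero_right orth_sym real_scaleR_def)

lemma orth_add: "D x z = 0 \<Longrightarrow> D y z = 0 \<Longrightarrow> D (x + y) z = 0"
  by (metis D_simps(1) add_0 orth_sym)

end

section \<open>Motion along spheres orthogonal to a vector\<close>

context symmetric_duality
begin

text \<open>The path on the sphere is the radial projection of the segment from \<open>l\<close> to
  \<open>l'\<close>. Antipodal endpoints are excluded because that segment passes through 0.\<close>

lemma norm_add_orth_const_aux:
  assumes orth: "D k l = 0" "D k l' = 0" and eq: "norm l = norm l'" and ne: "l \<noteq> 0" "l' \<noteq> - l"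
  shows "norm (l + k) = norm (l' + k)"
proof (cases "k = 0")
  case False
  define r where "r = norm l"
  define v where "v = l' - l"
  define m where "m s = l + s *\<^sub>R v" for s :: real
  define q where "q s = (r / norm (m s)) *\<^sub>R m s + k" for s
  have r: "0 < r" using ne by (simp add: r_def)
  have m0: "m s \<noteq> 0" if "0 \<le> s" "s \<le> 1" for s
  proof
    assume "m s = 0"
    then have z: "(1 - s) *\<^sub>R l = - (s *\<^sub>R l')" by (simp add: m_def v_def algebra_simps eq_neg_iff_add_eq_0)
    then have "norm ((1 - s) *\<^sub>R l) = norm (s *\<^sub>R l')" by simp
    then have "(1 - s) * r = s * r" using that eq by (simp add: r_def)
    then have "s = 1 / 2" using r by simp
    with z have "(1/2) *\<^sub>R l = (1/2) *\<^sub>R (- l')" by simp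
    then have "l = - l'" by (simp only: scaleR_cancel_left) simp
    then show False using ne by simp
  qed
  have der: "((\<lambda>s. norm (q s)) has_real_derivative 0) (at s)" if s: "0 \<le> s" "s \<le> 1" for s
  proof -
    note ms = m0[OF s]
    \<comment> \<open>This is the velocity of the projected path by the product rule; the second
      term removes the radial part of the first.\<close>
    define w where "w = (r / norm (m s)) *\<^sub>R v + (- (r * D (m s) v / (norm (m s))\<^sup>2)) *\<^sub>R m s"
    have md: "(m has_vector_derivative v) (at s)" unfolding m_def by (auto intro!: derivative_eq_intros)
    have nd: "((\<lambda>s. norm (m s)) has_real_derivative D (m s) v) (at s)"
      using norm_has_derivative_along[OF md ms] .
    have rd: "((\<lambda>s. r / norm (m s)) has_real_derivative - (r * D (m s) v / (norm (m s))\<^sup>2)) (at s)"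
      using nd ms by (auto intro!: derivative_eq_intros simp: power2_eq_square)
    have "((\<lambda>s. (r / norm (m s)) *\<^sub>R m s + k) has_vector_derivative w + 0) (at s)"
      unfolding w_def
      by (intro has_vector_derivative_add has_vector_derivative_const has_vector_derivative_scaleR rd md)
    then have qd: "(q has_vector_derivative w) (at s)" unfolding q_def[abs_def] by simp
    have km: "D k (m s) = 0" and kv: "D k v = 0" using orth by (simp_all add: m_def v_def D_simps)
    have "D (m s) w = 0"
      unfolding w_def using ms by (simp add: D_simps D_self field_simps power2_eq_square)
    moreover have kw: "D k w = 0" unfolding w_def using km kv by (simp add: D_simps)
    ultimately have "D (q s) w = 0"
      unfolding q_def using orth_scale[of "m s" w "r / norm (m s)" 1] by (intro orth_add) auto
    \<comment> \<open>The constant value under \<open>D k\<close> keeps \<open>q s\<close> away from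
      0, where the norm is not differentiable.\<close>
    moreover have "D k (q s) = norm k" using km by (simp add: q_def D_simps D_self)
    then have "q s \<noteq> 0" using False by (auto simp: D_simps)
    ultimately show ?thesis using norm_has_derivative_along[OF qd] by simp
  qed
  have "norm (q 1) = norm (q 0)"
    using der by (intro DERIV_isconst_end)
      (auto intro!: continuous_at_imp_continuous_on DERIV_isCont)
  moreover have "q 0 = l + k" "q 1 = l' + k"
    using r eq by (auto simp: q_def m_def v_def r_def)
  ultimately show ?thesis by simp
qed (use eq in simp)

end

section \<open>Euclidean geometry in dimension at least three\<close>

locale symmetric_duality_3 = symmetric_duality D for D :: "'a::real_normed_vector \<Rightarrow> 'a \<Rightarrow> real" +
  assumes dim3: "\<exists>x. x \<notin> span {a::'a, b}"
begin

text \<open>Antipodal points are joined in two stages, through a vector \<open>m\<close> of the same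
  sphere that is not a multiple of \<open>l\<close>; the third dimension supplies it.\<close>

lemma norm_add_orth_const:
  assumes orth: "D k l = 0" "D k l' = 0" and eq: "norm l = norm l'"
  shows "norm (l + k) = norm (l' + k)"
proof (cases "l \<noteq> 0 \<and> k \<noteq> 0 \<and> l' = - l")
  case True
  obtain x where x: "x \<notin> span {l, k}" using dim3 by blast
  define y where "y = x - (D k x / norm k) *\<^sub>R k"
  have yl: "y \<noteq> c *\<^sub>R l" for c
  proof
    assume "y = c *\<^sub>R l"
    then have "x = c *\<^sub>R l + (D k x / norm k) *\<^sub>R k" by (simp add: y_def algebra_simps)
    then show False using x by (metis insertI1 insert_commute span_add span_base span_scale)
  qed
  have y0: "y \<noteq> 0" using yl[of 0] by auto
  have ky: "D k y = 0" using True by (simp add: y_def D_simps D_self)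
  define m where "m = (norm l / norm y) *\<^sub>R y"
  have m: "D k m = 0" "norm m = norm l" using ky y0 by (auto simp: m_def D_simps)
  have "m \<noteq> c *\<^sub>R l" for c
  proof
    assume "m = c *\<^sub>R l"
    then have "(norm y / norm l) *\<^sub>R m = (norm y / norm l * c) *\<^sub>R l" by simp
    moreover have "(norm y / norm l) *\<^sub>R m = y" using y0 True by (simp add: m_def)
    ultimately show False using yl by metis
  qed
  from this[of "-1"] this[of 1] have "m \<noteq> - l" "- l \<noteq> - m" by auto
  moreover have "m \<noteq> 0" using m(2) True by auto
  ultimately have "norm (l + k) = norm (m + k)" "norm (m + k) = norm (l' + k)"
    using norm_add_orth_const_aux[OF orth(1) m(1)] norm_add_orth_const_aux[OF m(1) orth(2)] m True by auto
  then show ?thesis by simp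
next
  case False
  then consider "l = 0" | "k = 0" | "l \<noteq> 0" "l' \<noteq> - l" by blast
  then show ?thesis
  proof cases
    case 1 then have "l' = 0" using eq by simp
    with 1 show ?thesis by simp
  qed (use eq norm_add_orth_const_aux[OF orth eq] in auto)
qed

lemma norm_comb_cong:
  assumes "D k l = 0" "D k l' = 0" "norm l = norm l'"
  shows "norm (a *\<^sub>R l + b *\<^sub>R k) = norm (a *\<^sub>R l' + b *\<^sub>R k)"
  using assms by (auto intro!: norm_add_orth_const simp: orth_scale)

lemma third_direction:
  assumes "norm l = 1" "norm k = 1" "D l k = 0"
  obtains m where "norm m = 1" "D m l = 0" "D m k = 0"
proof -
  obtain x where x: "x \<notin> span {l, k}" using dim3 by blast
  define y where "y = x - D l x *\<^sub>R l - D k x *\<^sub>R k"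
  have "y \<noteq> 0"
  proof
    assume "y = 0"
    then have "x = D l x *\<^sub>R l + D k x *\<^sub>R k" by (simp add: y_def algebra_simps)
    then show False using x by (metis insertI1 insert_commute span_add span_base span_scale)
  qed
  have kl: "D k l = 0" using orth_sym assms(3) by blast
  have "D l y = 0" "D k y = 0" using assms kl by (auto simp: y_def D_simps D_self)
  then have "D (y /\<^sub>R norm y) l = 0" "D (y /\<^sub>R norm y) k = 0"
    using orth_scale[of y l _ 1] orth_scale[of y k _ 1] orth_sym by auto
  moreover have "norm (y /\<^sub>R norm y) = 1" using \<open>y \<noteq> 0\<close> by simp
  ultimately show thesis using that by blast
qed

text \<open>With a third orthogonal direction \<open>m\<close> the pair is turned by replacing one
  vector at a time: \<open>l\<close> by \<open>m\<close>, \<open>k\<close> by \<open>l\<close>,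
  \<open>m\<close> by \<open>k\<close>, and finally \<open>l\<close> by \<open>- l\<close>.\<close>

lemma norm_quarter_turn:
  assumes "norm l = 1" "norm k = 1" "D l k = 0"
  shows "norm (s *\<^sub>R l + t *\<^sub>R k) = norm (- t *\<^sub>R l + s *\<^sub>R k)"
proof -
  obtain m where m: "norm m = 1" "D m l = 0" "D m k = 0" using third_direction[OF assms] .
  note o = assms(3) orth_sym[OF assms(3)] m(2,3) orth_sym[OF m(2)] orth_sym[OF m(3)]
  have "norm (s *\<^sub>R l + t *\<^sub>R k) = norm (s *\<^sub>R m + t *\<^sub>R k)"
    using o assms m by (intro norm_comb_cong) auto
  also have "\<dots> = norm (t *\<^sub>R l + s *\<^sub>R m)"
    using norm_comb_cong[of m k l t s] o assms m by (simp add: add.commute)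
  also have "\<dots> = norm (s *\<^sub>R k + t *\<^sub>R l)"
    using norm_comb_cong[of l m k s t] o assms m by (simp add: add.commute)
  also have "\<dots> = norm (t *\<^sub>R (- l) + s *\<^sub>R k)"
    using norm_comb_cong[of k l "- l" t s] o assms m by (simp add: add.commute D_simps)
  finally show ?thesis by simp
qed

text \<open>The turn carries the line \<open>p + t r\<close> to \<open>r - t p\<close> and preserves
  norms. Comparing derivatives at 0 gives \<open>D p r = - D r p\<close>, while
  \<open>D_same_sign\<close> forbids opposite signs.\<close>

lemma orth_quarter_turn:
  assumes "norm l = 1" "norm k = 1" "D l k = 0"
  shows "D (a *\<^sub>R l + b *\<^sub>R k) (- b *\<^sub>R l + a *\<^sub>R k) = 0"
proof -
  define p where "p = a *\<^sub>R l + b *\<^sub>R k"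
  define r where "r = - b *\<^sub>R l + a *\<^sub>R k"
  have "norm (p + t *\<^sub>R r) = norm (r + t *\<^sub>R (- p))" for t
    using norm_quarter_turn[OF assms, of "a - t * b" "b + t * a"]
    by (simp add: p_def r_def algebra_simps)
  then have eq: "(\<lambda>t. norm (p + t *\<^sub>R r)) = (\<lambda>t. norm (r + t *\<^sub>R (- p)))" by blast
  show ?thesis
  proof (cases "p = 0")
    case False
    have "norm p = norm r" using fun_cong[OF eq, of 0] by simp
    then have "r \<noteq> 0" using False by auto
    then have "D p r = D r (- p)"
      using DERIV_unique[OF norm_has_derivative_line[OF False, of r]] norm_has_derivative_line[of r "- p"] eq by simp
    then have "D p r * D p r \<le> 0" using D_same_sign[of p r] by (simp add: D_simps)
    then show ?thesis unfolding p_def r_def by (metis mult_eq_0_iff order_antisym zero_le_square)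
  qed (simp add: p_def D_zero)
qed

text \<open>In the coordinates of an orthonormal pair the norm is multiplicative for complex multiplication and
  invariant under conjugation; multiplying a vector by its conjugate identifies it as the modulus.\<close>

lemma norm_orthonormal:
  assumes "norm l = 1" "norm k = 1" "D l k = 0"
  shows "(norm (a *\<^sub>R l + b *\<^sub>R k))\<^sup>2 = a\<^sup>2 + b\<^sup>2"
proof -
  obtain m where m: "norm m = 1" "D m l = 0" "D m k = 0" using third_direction[OF assms] .
  note kl = orth_sym[OF assms(3)] and lm = orth_sym[OF m(2)]
  define p where "p = a *\<^sub>R l + b *\<^sub>R k"
  define r where "r = - b *\<^sub>R l + a *\<^sub>R k"
  have pr: "D p r = 0" using orth_quarter_turn[OF assms] by (simp add: p_def r_def)
  have nr: "norm r = norm p" using norm_quarter_turn[OF assms, of a b] by (simp add: p_def r_def)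
  have mp: "D m p = 0" using m by (simp add: p_def D_simps)
  \<comment> \<open>The swaps replace \<open>r\<close> by \<open>norm p *\<^sub>R m\<close>, then
    \<open>p\<close> by \<open>norm p *\<^sub>R l\<close>, then \<open>- m\<close> by
    \<open>k\<close>, ending at \<open>norm p *\<^sub>R p\<close>. Expanding the starting vector
    directly gives a multiple of \<open>l\<close>.\<close>
  have "norm (a *\<^sub>R p + (- b) *\<^sub>R r) = norm (a *\<^sub>R p + (- b) *\<^sub>R (norm p *\<^sub>R m))"
    using norm_comb_cong[of p r "norm p *\<^sub>R m" "- b" a] pr nr m orth_sym[OF mp]
    by (simp add: D_simps add.commute)
  also have "\<dots> = norm (a *\<^sub>R (norm p *\<^sub>R l) + (- b) *\<^sub>R (norm p *\<^sub>R m))"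
    using norm_comb_cong[of m p "norm p *\<^sub>R l" a "- b * norm p"] mp m assms
    by (simp add: D_simps)
  also have "\<dots> = norm (a *\<^sub>R (norm p *\<^sub>R l) + (b * norm p) *\<^sub>R k)"
    using norm_comb_cong[of l "- m" k "b * norm p" "a * norm p"] lm assms m
    by (simp add: D_simps add.commute)
  also have "\<dots> = norm (norm p *\<^sub>R p)" by (simp add: p_def algebra_simps)
  finally have "norm (a *\<^sub>R p + (- b) *\<^sub>R r) = (norm p)\<^sup>2" by (simp add: power2_eq_square)
  moreover have "a *\<^sub>R p + (- b) *\<^sub>R r = (a\<^sup>2 + b\<^sup>2) *\<^sub>R l"
    by (simp add: p_def r_def algebra_simps power2_eq_square)
  ultimately show ?thesis using assms(1) by (simp add: p_def)
qed

lemma pythagoras: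
  assumes "D y z = 0"
  shows "(norm (a *\<^sub>R y + z))\<^sup>2 = a\<^sup>2 * (norm y)\<^sup>2 + (norm z)\<^sup>2"
proof (cases "y = 0 \<or> z = 0")
  case False
  then have "D (y /\<^sub>R norm y) (z /\<^sub>R norm z) = 0" using assms orth_scale by blast
  from norm_orthonormal[OF _ _ this, of "a * norm y" "norm z"] False
  have "(norm ((a * norm y) *\<^sub>R (y /\<^sub>R norm y) + norm z *\<^sub>R (z /\<^sub>R norm z)))\<^sup>2 = (a * norm y)\<^sup>2 + (norm z)\<^sup>2"
    by simp
  moreover have "(a * norm y) *\<^sub>R (y /\<^sub>R norm y) = a *\<^sub>R y" "norm z *\<^sub>R (z /\<^sub>R norm z) = z"
    using False by simp_all
  ultimately show ?thesis by (simp only: power_mult_distrib)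
qed (auto simp: power_mult_distrib)

text \<open>This is the symmetry of the future inner product. Splitting \<open>x\<close> along
  \<open>y\<close> makes the squared norm of \<open>x + t *\<^sub>R y\<close> an explicit quadratic
  in \<open>t\<close>; its derivative at 0 is computed in two ways.\<close>

lemma norm_mult_D_sym: "norm y * D y x = norm x * D x y"
proof (cases "x = 0 \<or> y = 0")
  case False
  define \<alpha> where "\<alpha> = D y x / norm y"
  define z where "z = x - \<alpha> *\<^sub>R y"
  have "D y z = 0" using False by (simp add: z_def \<alpha>_def D_simps D_self)
  moreover have "x + t *\<^sub>R y = (\<alpha> + t) *\<^sub>R y + z" for t by (simp add: z_def algebra_simps)
  ultimately have eq: "(\<lambda>t. (norm (x + t *\<^sub>R y))\<^sup>2) = (\<lambda>t. (\<alpha> + t)\<^sup>2 * (norm y)\<^sup>2 + (norm z)\<^sup>2)"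
    using pythagoras by simp
  have nd: "((\<lambda>t. norm (x + t *\<^sub>R y)) has_real_derivative D x y) (at 0)"
    using norm_has_derivative_line False by blast
  have "((\<lambda>t. (norm (x + t *\<^sub>R y))\<^sup>2) has_real_derivative 2 * (norm x * D x y)) (at 0)"
    using nd by (auto intro!: derivative_eq_intros)
  moreover have "((\<lambda>t. (\<alpha> + t)\<^sup>2 * (norm y)\<^sup>2 + (norm z)\<^sup>2) has_real_derivative 2 * (\<alpha> * (norm y)\<^sup>2)) (at 0)"
    by (auto intro!: derivative_eq_intros)
  ultimately have "norm x * D x y = \<alpha> * (norm y)\<^sup>2" unfolding eq using DERIV_unique by force
  then show ?thesis using False by (simp add: \<alpha>_def power2_eq_square)
qed (auto simp: D_zero D_simps)

lemma norm_from_inner_product: "norm_from_inner_product TYPE('a)"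
  unfolding norm_from_inner_product_def
proof (intro exI[of _ "\<lambda>x y. norm y * D y x"] conjI allI)
  show "norm y * D y x = norm x * D x y" for x y by (rule norm_mult_D_sym)
  show "linear (\<lambda>x. norm y * D y x)" for y
    by (intro linearI) (auto simp: D_simps algebra_simps)
qed (auto simp: D_self)

end

section \<open>The two-dimensional case\<close>

text \<open>The sublevel set at height \<open>Q y\<close> is closed, convex and contains the orbit
  of \<open>y\<close>, hence the unit ball. Exchanging \<open>x\<close> and \<open>y\<close> gives
  equality.\<close>

lemma convex_transitive_invariant_const:
  fixes Q :: "'a::real_normed_vector \<Rightarrow> real"
  assumes ct: "convex_transitive TYPE('a)" and cont: "continuous_on UNIV Q" and conv: "convex_on UNIV Q"
    and inv: "\<And>T x. T \<in> isometry_group \<Longrightarrow> Q (T x) = Q x"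
    and xy: "norm x = 1" "norm y = 1"
  shows "Q x = Q y"
proof -
  have "Q x \<le> Q y" if "norm x = 1" "norm y = 1" for x y
  proof -
    have "convex {x. Q x \<le> Q y}"
    proof (rule convexI)
      fix v w :: 'a and s t :: real
      assume *: "v \<in> {x. Q x \<le> Q y}" "w \<in> {x. Q x \<le> Q y}" "0 \<le> s" "0 \<le> t" "s + t = 1"
      then have "Q (s *\<^sub>R v + t *\<^sub>R w) \<le> s * Q v + t * Q w"
        using conv unfolding convex_on_def by blast
      also have "\<dots> \<le> s * Q y + t * Q y" using * by (intro add_mono mult_left_mono) auto
      also have "\<dots> = Q y" using \<open>s + t = 1\<close> by (metis distrib_right mult_1)
      finally show "s *\<^sub>R v + t *\<^sub>R w \<in> {x. Q x \<le> Q y}" by simp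
    qed
    moreover have "closed {x. Q x \<le> Q y}"
      by (intro closed_Collect_le cont continuous_on_const)
    ultimately have "closure (convex hull {T y | T. T \<in> isometry_group}) \<subseteq> {x. Q x \<le> Q y}"
      using inv by (intro closure_minimal hull_minimal) auto
    moreover have "x \<in> closure (convex hull {T y | T. T \<in> isometry_group})"
      using ct that unfolding convex_transitive_def by simp
    ultimately show ?thesis by auto
  qed
  then show ?thesis using xy by (meson order_antisym)
qed

text \<open>Two distinct positive definite symmetric matrices of equal determinant have a midpoint
  of larger determinant. The defect, multiplied by \<open>p * p'\<close>, is a sum of
  squares.\<close>

lemma det2_midpoint_unique:
  fixes p q r p' q' r' d :: real
  assumes "0 < p" "0 < p'" "0 < d" and d: "p * r - q\<^sup>2 = d" "p' * r' - q'\<^sup>2 = d"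
    and mid: "(p + p') / 2 * ((r + r') / 2) - ((q + q') / 2)\<^sup>2 \<le> d"
  shows "p' = p" "q' = q" "r' = r"
proof -
  have cross: "p * r' + p' * r - 2 * q * q' \<le> 2 * d"
    using mid d by (simp add: field_simps power2_eq_square)
  have "d * (p - p')\<^sup>2 + (p * q' - p' * q)\<^sup>2 = p * p' * (p * r' + p' * r - 2 * q * q') - 2 * d * (p * p')"
  proof -
    have "d * p\<^sup>2 = p\<^sup>2 * (p' * r' - q'\<^sup>2)" "d * p'\<^sup>2 = p'\<^sup>2 * (p * r - q\<^sup>2)" using d by simp_all
    then show ?thesis by (simp add: power2_eq_square algebra_simps)
  qed
  also have "\<dots> \<le> 0"
    using mult_left_mono[OF cross, of "p * p'"] assms(1,2) by (simp add: algebra_simps)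
  finally have le: "d * (p - p')\<^sup>2 + (p * q' - p' * q)\<^sup>2 \<le> 0" .
  moreover have "0 \<le> d * (p - p')\<^sup>2" "0 \<le> (p * q' - p' * q)\<^sup>2" using assms(3) by simp_all
  ultimately have "d * (p - p')\<^sup>2 = 0" "(p * q' - p' * q)\<^sup>2 = 0" by linarith+
  then show p: "p' = p" and q: "q' = q" using assms(1,3) by auto
  have "p * r' = p * r" using d unfolding p q by linarith
  then show "r' = r" using assms(1) by simp
qed

text \<open>Among the quadratic forms dominated by the squared norm, the one of largest determinant is unique, hence
  invariant under all isometries.\<close>

lemma convex_transitive_plane:
  fixes u k :: "'a::real_normed_vector"
  assumes ct: "convex_transitive TYPE('a)"
    and a: "linear a" "\<And>x. \<bar>a x\<bar> \<le> norm x" and b: "linear b" "\<And>x. \<bar>b x\<bar> \<le> norm x"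
    and u: "norm u = 1" "a u = 1" "b u = 0" and k: "norm k = 1" "a k = 0" "b k = 1"
    and coords: "\<And>x. x = a x *\<^sub>R u + b x *\<^sub>R k"
  shows "norm_from_inner_product TYPE('a)"
proof -
  note lin = linear_add[OF a(1)] linear_add[OF b(1)] linear_diff[OF a(1)] linear_diff[OF b(1)]
    linear_scale[OF a(1)] linear_scale[OF b(1)]
  define Q where "Q p q r x = p * (a x)\<^sup>2 + 2 * q * (a x * b x) + r * (b x)\<^sup>2" for p q r x
  \<comment> \<open>Triples \<open>(p, q, r)\<close> are symmetric matrices in the coordinates
    \<open>a\<close>, \<open>b\<close>. Only the diagonal is required to be nonnegative, which keeps
    \<open>K\<close> closed by simple inequalities.\<close>
  define K where "K = {(p, q, r). 0 \<le> p \<and> 0 \<le> r \<and> (\<forall>x. Q p q r x \<le> (norm x)\<^sup>2)}"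
  define det where "det = (\<lambda>(p::real, q::real, r::real). p * r - q\<^sup>2)"
  have Q_scale: "Q p q r (c *\<^sub>R x) = c\<^sup>2 * Q p q r x" for p q r c x
    by (simp add: Q_def lin power2_eq_square algebra_simps)
  have "K = {t. 0 \<le> fst t} \<inter> {t. 0 \<le> snd (snd t)} \<inter>
      (\<Inter>x. {t. Q (fst t) (fst (snd t)) (snd (snd t)) x \<le> (norm x)\<^sup>2})"
    by (auto simp: K_def)
  moreover have "closed \<dots>"
    unfolding Q_def by (intro closed_Int closed_INT ballI closed_Collect_le continuous_intros)
  ultimately have "closed K" by simp
  have "K \<subseteq> {0..1} \<times> {-2..2} \<times> {0..1}"
  proof (clarsimp simp: K_def)
    fix p q r assume pr: "0 \<le> p" "0 \<le> r" and le: "\<forall>x. Q p q r x \<le> (norm x)\<^sup>2"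
    have "norm (u + k) \<le> 2" "norm (u - k) \<le> 2"
      using norm_triangle_ineq[of u k] norm_triangle_ineq4[of u k] u k by simp_all
    then have "(norm (u + k))\<^sup>2 \<le> 4" "(norm (u - k))\<^sup>2 \<le> 4"
      using power_mono[of _ 2 2] by fastforce+
    then have "Q p q r (u + k) \<le> 4" "Q p q r (u - k) \<le> 4" using le order_trans by blast+
    then show "p \<le> 1 \<and> - 2 \<le> q \<and> q \<le> 2 \<and> r \<le> 1"
      using le[rule_format, of u] le[rule_format, of k] pr u k by (auto simp: Q_def lin)
  qed
  moreover have "compact ({0..1} \<times> {-2..2} \<times> {0..1::real} :: (real \<times> real \<times> real) set)"
    by (intro compact_Times) auto
  ultimately have "compact K" using \<open>closed K\<close> by (metis compact_Int_closed inf.absorb_iff2)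
  \<comment> \<open>This member has determinant 1/4, so the maximal determinant is positive.\<close>
  have half: "(1/2, 0, 1/2) \<in> K"
  proof -
    have "(a x)\<^sup>2 \<le> (norm x)\<^sup>2" "(b x)\<^sup>2 \<le> (norm x)\<^sup>2" for x
      using a(2)[of x] b(2)[of x] by (simp_all add: abs_le_square_iff[symmetric])
    then have "(a x)\<^sup>2 + (b x)\<^sup>2 \<le> 2 * (norm x)\<^sup>2" for x by (metis add_mono mult_2)
    then show ?thesis by (simp add: K_def Q_def field_simps)
  qed
  have "continuous_on K det" unfolding det_def case_prod_unfold by (intro continuous_intros)
  then obtain m where m: "m \<in> K" "\<And>t. t \<in> K \<Longrightarrow> det t \<le> det m"
    using continuous_attains_sup[OF \<open>compact K\<close>] half by blast
  obtain p q r where pqr: "m = (p, q, r)" by (metis prod_cases3)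
  define d where "d = p * r - q\<^sup>2"
  have "1/4 \<le> d" using m(2)[OF half] by (simp add: det_def pqr d_def)
  then have d: "0 < d" by simp
  have pr0: "0 \<le> p" "0 \<le> r" and Qle: "\<And>x. Q p q r x \<le> (norm x)\<^sup>2" using m(1) by (auto simp: K_def pqr)
  have dmax: "p' * r' - q'\<^sup>2 \<le> d" if "(p', q', r') \<in> K" for p' q' r'
    using m(2)[OF that] by (simp add: det_def pqr d_def)
  have pos: "0 < p'" if "0 \<le> p'" "p' * r' - q'\<^sup>2 = d" for p' q' r'
  proof (rule ccontr)
    assume "\<not> 0 < p'"
    then have "p' = 0" using that by simp
    then have "- q'\<^sup>2 = d" using that(2) by simp
    then show False using d zero_le_power2[of q'] by linarith
  qed
  have p: "0 < p" using pos[of p r q] pr0 d_def by simp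
  \<comment> \<open>A positive determinant and \<open>p > 0\<close> give semidefiniteness by
    completing the square.\<close>
  have Q_nonneg: "0 \<le> Q p q r x" for x
  proof -
    have "p * Q p q r x = (p * a x + q * b x)\<^sup>2 + d * (b x)\<^sup>2"
      by (simp add: Q_def d_def power2_eq_square algebra_simps)
    also have "\<dots> \<ge> 0" using d by simp
    finally show ?thesis using p by (simp add: zero_le_mult_iff)
  qed
  define \<delta> where "\<delta> T = a (T u) * b (T k) - a (T k) * b (T u)" for T
  have comp: "a (T x) = a x * a (T u) + b x * a (T k)" "b (T x) = a x * b (T u) + b x * b (T k)"
    if "T \<in> isometry_group" for T x
  proof -
    have T: "linear T" using that by (simp add: isometry_group_def)
    have "T x = a x *\<^sub>R T u + b x *\<^sub>R T k"
      by (subst coords[of x]) (simp add: linear_add[OF T] linear_scale[OF T])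
    then show "a (T x) = a x * a (T u) + b x * a (T k)" "b (T x) = a x * b (T u) + b x * b (T k)"
      by (simp_all add: lin)
  qed
  \<comment> \<open>The off-diagonal coefficient of the form pulled back by \<open>T\<close>; the
    diagonal ones are the values at \<open>T u\<close> and \<open>T k\<close>.\<close>
  define q' where "q' T = p * (a (T u) * a (T k)) + q * (a (T u) * b (T k) + a (T k) * b (T u)) + r * (b (T u) * b (T k))" for T
  have QT: "Q p q r (T x) = Q (Q p q r (T u)) (q' T) (Q p q r (T k)) x" if "T \<in> isometry_group" for T x
    by (simp add: Q_def[of _ _ _ x] Q_def[of p q r "T x"] comp[OF that, of x])
       (simp add: Q_def q'_def power2_eq_square algebra_simps)
  have inK: "(Q p q r (T u), q' T, Q p q r (T k)) \<in> K" if T: "T \<in> isometry_group" for T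
  proof -
    have "Q p q r (T x) \<le> (norm x)\<^sup>2" for x using Qle[of "T x"] T by (simp add: isometry_group_def)
    then show ?thesis by (simp add: K_def Q_nonneg QT[OF T, symmetric])
  qed
  have detT: "Q p q r (T u) * Q p q r (T k) - (q' T)\<^sup>2 = d * (\<delta> T)\<^sup>2" for T
    by (simp add: Q_def q'_def d_def \<delta>_def power2_eq_square algebra_simps)
  have \<delta>_le: "(\<delta> T)\<^sup>2 \<le> 1" if "T \<in> isometry_group" for T
    using dmax[OF inK[OF that]] d unfolding detT by simp
  \<comment> \<open>Maximality bounds the squared determinants of \<open>T\<close> and of
    \<open>inv T\<close> by 1, and their product is 1.\<close>
  have \<delta>: "(\<delta> T)\<^sup>2 = 1" if T: "T \<in> isometry_group" for T
  proof -
    note Ti = isometry_group_inv[OF T]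
    have "\<delta> (inv T) * \<delta> T = 1"
    proof -
      have eqs: "a (T u) * a (inv T u) + b (T u) * a (inv T k) = 1"
        "a (T u) * b (inv T u) + b (T u) * b (inv T k) = 0"
        "a (T k) * a (inv T u) + b (T k) * a (inv T k) = 0"
        "a (T k) * b (inv T u) + b (T k) * b (inv T k) = 1"
        using comp[OF Ti(1), of "T u"] comp[OF Ti(1), of "T k"] u k by (simp_all add: Ti)
      have "\<delta> (inv T) * \<delta> T =
        (a (T u) * a (inv T u) + b (T u) * a (inv T k)) * (a (T k) * b (inv T u) + b (T k) * b (inv T k)) -
        (a (T k) * a (inv T u) + b (T k) * a (inv T k)) * (a (T u) * b (inv T u) + b (T u) * b (inv T k))"
        by (simp add: \<delta>_def algebra_simps)
      then show ?thesis unfolding eqs by simp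
    qed
    then have "(\<delta> (inv T))\<^sup>2 * (\<delta> T)\<^sup>2 = 1" by (metis power_mult_distrib power_one)
    moreover have "(\<delta> (inv T))\<^sup>2 * (\<delta> T)\<^sup>2 \<le> 1 * (\<delta> T)\<^sup>2"
      using \<delta>_le[OF Ti(1)] by (intro mult_right_mono) auto
    ultimately show ?thesis using \<delta>_le[OF T] by simp
  qed
  have inv: "Q p q r (T x) = Q p q r x" if T: "T \<in> isometry_group" for T x
  proof -
    define p1 q1 r1 where "p1 = Q p q r (T u)" and "q1 = q' T" and "r1 = Q p q r (T k)"
    have K1: "(p1, q1, r1) \<in> K" using inK[OF T] by (simp add: p1_def q1_def r1_def)
    then have K1': "0 \<le> p1" "0 \<le> r1" "\<And>x. Q p1 q1 r1 x \<le> (norm x)\<^sup>2" by (auto simp: K_def)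
    have d1: "p1 * r1 - q1\<^sup>2 = d" using detT[of T] \<delta>[OF T] by (simp add: p1_def q1_def r1_def)
    \<comment> \<open>The mean of the maximal form and its pullback is again admissible, so strict
      concavity identifies them.\<close>
    have "Q ((p + p1) / 2) ((q + q1) / 2) ((r + r1) / 2) x \<le> (norm x)\<^sup>2" for x
    proof -
      have "Q ((p + p1) / 2) ((q + q1) / 2) ((r + r1) / 2) x = (Q p q r x + Q p1 q1 r1 x) / 2"
        by (simp add: Q_def field_simps)
      also have "\<dots> \<le> (norm x)\<^sup>2" using add_mono[OF Qle[of x] K1'(3)[of x]] by simp
      finally show ?thesis .
    qed
    then have "((p + p1) / 2, (q + q1) / 2, (r + r1) / 2) \<in> K"
      using pr0 K1'(1,2) by (simp add: K_def)
    from dmax[OF this] have "p1 = p" "q1 = q" "r1 = r"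
      using det2_midpoint_unique[OF p pos[OF K1'(1) d1] d d_def[symmetric] d1] by auto
    moreover have "Q p q r (T x) = Q p1 q1 r1 x" unfolding p1_def q1_def r1_def by (rule QT[OF T])
    ultimately show ?thesis by (simp only:)
  qed
  have cont: "continuous_on UNIV (Q p q r)"
    unfolding Q_def
    by (intro continuous_intros linear_continuous_on bounded_linear_of_le_norm a b)
  have conv: "convex_on UNIV (Q p q r)"
  proof (rule convex_onI)
    fix t x y assume t: "0 < t" "t < (1::real)"
    have "Q p q r ((1 - t) *\<^sub>R x + t *\<^sub>R y) = (1 - t) * Q p q r x + t * Q p q r y - t * (1 - t) * Q p q r (x - y)"
      by (simp add: Q_def lin power2_eq_square algebra_simps)
    also have "\<dots> \<le> (1 - t) * Q p q r x + t * Q p q r y" using t Q_nonneg[of "x - y"] by simp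
    finally show "Q p q r ((1 - t) *\<^sub>R x + t *\<^sub>R y) \<le> (1 - t) * Q p q r x + t * Q p q r y" .
  qed simp
  have Q_norm: "Q p q r x = p * (norm x)\<^sup>2" for x
  proof (cases "x = 0")
    case False
    have "Q p q r (x /\<^sub>R norm x) = Q p q r u"
    proof (rule convex_transitive_invariant_const[OF ct cont conv])
      show "Q p q r (T x) = Q p q r x" if "T \<in> isometry_group" for T x using inv[OF that] .
    qed (use False u in auto)
    also have "\<dots> = p" by (simp add: Q_def u)
    finally show ?thesis using False Q_scale[of p q r "norm x" "x /\<^sub>R norm x"] by simp
  qed (simp add: Q_def linear_0[OF a(1)] linear_0[OF b(1)])
  define ip where "ip x y = (p * (a x * a y) + q * (a x * b y + a y * b x) + r * (b x * b y)) / p" for x y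
  have self: "ip x x = (norm x)\<^sup>2" for x
    using Q_norm[of x] p by (simp add: ip_def Q_def field_simps power2_eq_square)
  show ?thesis unfolding norm_from_inner_product_def
  proof (intro exI[of _ ip] conjI allI)
    show "ip x y = ip y x" for x y by (simp add: ip_def algebra_simps)
    show "linear (\<lambda>x. ip x y)" for y
      using p by (intro linearI) (auto simp: ip_def lin field_simps)
  qed (auto simp: self)
qed

section \<open>Construction of the duality map and division by dimension\<close>

theorem theorem5p1:
  fixes u :: "'a::banach"
    and P :: "'a \<Rightarrow> 'a"
  assumes "convex_transitive TYPE('a)"
    and "norm u = 1"
    and "projection_onto P (span {u})"
    and "bicontractive P"
    and "sphere 0 1 \<subseteq> closure (weakly_exposed_points :: 'a set)"
    and "usc_at (subtopology weak_topology (sphere (0::'a) 1))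
               (\<lambda>x. (\<lambda>g. g u) ` duality_map x) u"
  shows "norm_from_inner_product TYPE('a)"
proof -
  note ct = assms(1) and u = assms(2) and dense = assms(5) and usc = assms(6)
  obtain f where f: "contractive_pair u f" "f u = 1"
    by (rule bicontractive_contractive_pair[OF assms(2-4)])
  have pairs: "\<exists>\<psi>. contractive_pair x \<psi> \<and> \<psi> x = 1" if x: "norm x = 1" for x :: 'a
    by (rule unit_vector_contractive_pair[OF ct dense usc u f x]) blast
  have "\<exists>\<psi>. contractive_pair (x /\<^sub>R norm x) \<psi> \<and> \<psi> (x /\<^sub>R norm x) = 1" if "x \<noteq> 0" for x :: 'a
    using that by (intro pairs) simp
  then obtain D' where D': "\<And>x::'a. x \<noteq> 0 \<Longrightarrow> contractive_pair (x /\<^sub>R norm x) (D' x)"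
    "\<And>x::'a. x \<noteq> 0 \<Longrightarrow> D' x (x /\<^sub>R norm x) = 1" by metis
  define D where "D x = (if x = 0 then (\<lambda>_. 0) else D' x)" for x
  have lin: "linear (D x)" and le: "\<bar>D x v\<bar> \<le> norm v" for x v
    using D'(1)[of x] by (auto simp: D_def contractive_pair_def linear_zero)
  interpret symmetric_duality D
  proof (rule symmetric_duality.intro)
    show "linear (D x)" for x by (rule lin)
    show "\<bar>D x v\<bar> \<le> norm v" for x v by (rule le)
    show self: "D x x = norm x" for x
      using D'(2)[of x] lin[of x] by (auto simp: D_def linear_scale field_simps)
    show "D 0 v = 0" for v by (simp add: D_def)
    show "norm (v - (D x v / norm x) *\<^sub>R x) \<le> norm v" for x v
      using D'(1)[of x] by (auto simp: D_def contractive_pair_def divide_inverse)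
    fix x :: 'a and g assume x: "x \<noteq> 0" and g: "linear g" "\<And>v. \<bar>g v\<bar> \<le> norm v" "g x = norm x"
    have n: "norm (x /\<^sub>R norm x) = 1" "g (x /\<^sub>R norm x) = 1" "D x (x /\<^sub>R norm x) = 1"
      using x g self lin[of x] by (auto simp: linear_scale)
    show "g = D x"
      \<comment> \<open>The uniqueness lemma yields an inequality only, so it is used in both
        orders.\<close>
      using support_functional_unique[OF ct dense pairs n(1) g(1,2) n(2) lin le n(3)]
        support_functional_unique[OF ct dense pairs n(1) lin le n(3) g(1,2) n(2)]
      by (intro ext order_antisym)
  qed
  have uu: "D u u = 1" using u by (simp add: D_self)
  show ?thesis
  proof (cases "\<forall>a b::'a. \<exists>x. x \<notin> span {a, b}")
    case True
    then interpret symmetric_duality_3 D by unfold_locales blast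
    show ?thesis by (rule norm_from_inner_product)
  next
    case False
    then obtain a b :: 'a where ab: "\<And>x. x \<in> span {a, b}" by blast
    show ?thesis
    proof (cases "\<forall>x. x = D u x *\<^sub>R u")
      case True
      then have n: "norm x = \<bar>D u x\<bar>" for x by (metis norm_scaleR u mult.right_neutral)
      show ?thesis unfolding norm_from_inner_product_def
        by (intro exI[of _ "\<lambda>x y. D u x * D u y"] conjI allI)
           (use True in \<open>auto simp: n D_simps algebra_simps intro!: linearI\<close>, metis scaleR_zero_left)
    next
      case False
      then obtain x0 where x0: "x0 \<noteq> D u x0 *\<^sub>R u" by blast
      define y where "y = x0 - D u x0 *\<^sub>R u"
      define k where "k = y /\<^sub>R norm y"
      have "y \<noteq> 0" using x0 by (simp add: y_def)
      then have nk: "norm k = 1" by (simp add: k_def)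
      have uk: "D u k = 0" by (simp add: k_def y_def D_simps uu)
      note ku = orth_sym[OF uk]
      have kk: "D k k = 1" using nk by (simp add: D_self)
      \<comment> \<open>A nonzero remainder after removing the components along \<open>u\<close> and
        \<open>k\<close> would give three independent vectors in the span of two.\<close>
      have coords: "x = D u x *\<^sub>R u + D k x *\<^sub>R k" for x
      proof (rule ccontr)
        define z where "z = x - D u x *\<^sub>R u - D k x *\<^sub>R k"
        assume "x \<noteq> D u x *\<^sub>R u + D k x *\<^sub>R k"
        then have z0: "z \<noteq> 0" by (simp add: z_def algebra_simps)
        have z: "D u z = 0" "D k z = 0" using uk ku uu kk by (auto simp: z_def D_simps)
        have kns: "k \<notin> span {u}"
        proof
          assume "k \<in> span {u}"
          then obtain c where c: "k = c *\<^sub>R u" by (auto simp: span_singleton)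
          then have "c = 0" using uk uu by (simp add: D_simps)
          then show False using c nk by simp
        qed
        have zns: "z \<notin> span {k, u}"
        proof
          assume "z \<in> span {k, u}"
          then obtain c where "z - c *\<^sub>R k \<in> span {u}" by (auto simp: span_insert)
          then obtain e where "z - c *\<^sub>R k = e *\<^sub>R u" by (auto simp: span_singleton)
          then have ce: "z = e *\<^sub>R u + c *\<^sub>R k" by (simp add: algebra_simps)
          have "e = 0" "c = 0" using z uu kk uk ku unfolding ce by (auto simp: D_simps)
          then show False using ce z0 by simp
        qed
        have "independent {z, k, u}"
          using kns zns u by (auto simp: independent_insert intro: dependent_single)
        moreover have "{z, k, u} \<subseteq> span {a, b}" using ab by blast
        ultimately have "card {z, k, u} \<le> card {a, b}"
          using independent_span_bound[of "{a, b}" "{z, k, u}"] by simp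
        moreover have "z \<noteq> k" "z \<noteq> u" "k \<noteq> u" using kns zns by (auto simp: span_base)
        then have "card {z, k, u} = 3" by simp
        moreover have "card {a, b} \<le> 2" by (simp add: card_insert_if)
        ultimately show False by simp
      qed
      show ?thesis
        by (rule convex_transitive_plane[OF ct linear_D D_le linear_D D_le u uu ku nk uk kk coords])
    qed
  qed
qed

end
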